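(* Let $\alpha>-1$, $a\in\mathbb R$, $a\neq0$, and $$W(x)=e^{-x}x^{\alpha}\begin{pmatrix}x(1+a^2x)&ax\\ ax&1\end{pmatrix},\qquad x\in(0,\infty).$$ The algebra $\mathcal D(W)$ is generated by $\{I,D_1,D_2,D_3\}$, where $$D_1=\partial^2xI+\partial\begin{pmatrix}\alpha+2-x&ax\\ 0&\alpha+1-x\end{pmatrix}+\begin{pmatrix}-\frac{a^2+1}{a^2}&a(\alpha+1)\\ 0&-\frac1{a^2}\end{pmatrix},$$ $$D_2=\partial^2\begin{pmatrix}0&-ax^2\\ 0&-x\end{pmatrix}+\partial\begin{pmatrix}x&-x\frac{a^2\alpha+3a^2+1}{a}\\ \frac1a&-\alpha-1\end{pmatrix}+\begin{pmatrix}\frac{a^2+1}{a^2}&-\frac{(a^2+1)(\alpha+1)}{a}\\ 0&0\end{pmatrix},$$ $$\begin{aligned}D_3={}&\partial^3\begin{pmatrix}ax^2&-x^2(a^2x+1)\\ x&-ax^2\end{pmatrix}+\partial^2\begin{pmatrix}ax(\alpha+5)+\frac{2x}{a}&-a^2x^2(\alpha+5)-x(2\alpha+x+4)\\ 2+\alpha&-ax(\alpha+2)-\frac{2x}{a}\end{pmatrix}\\ &+\partial\begin{pmatrix}\frac{2(a^2+1)(2+\alpha)-x}{a}&-\frac{x}{a^2}-2(a^2(\alpha+2)+1)x-(\alpha+2)(\alpha+1)\\ \frac1{a^2}&\frac{x-2(\alpha+1)}{a}\end{pmatrix}+\begin{pmatrix}-\frac{\alpha+1}{a}&\frac{(\alpha+1)(a^2\alpha-1)}{a^2}\\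 -\frac1{a^2}&\frac{\alpha+1}{a}\end{pmatrix}.\end{aligned}$$
   Context: For a weight matrix $W$ of size $N$ on an interval $(x_0,x_1)$ put $\langle P,Q\rangle_W=\int_{x_0}^{x_1}P(x)W(x)Q(x)^*\,dx$ for $P,Q\in\operatorname{Mat}_N(\mathbb C[x])$. The monic orthogonal polynomials of $W$ are the unique $P_n\in\operatorname{Mat}_N(\mathbb C[x])$, $n\ge0$, of degree $n$ with leading coefficient $I$ and $\langle P_n,P_m\rangle_W=0$ for $n\ne m$. Differential operators $D=\sum_{i=0}^s\partial^iF_i(x)$, $\partial=d/dx$, act on the right on matrix functions: $P\cdot D=\sum_i P^{(i)}F_i$, and products satisfy $P\cdot(D_1D_2)=(P\cdot D_1)\cdot D_2$. $\operatorname{Mat}_N(\Omega[x])$ is the algebra of such operators with coefficients $F_i\in\operatorname{Mat}_N(\mathbb C[x])$. $$\mathcal D(W)=\{D\in\operatorname{Mat}_N(\Omega[x]): P_n\cdot D=\Lambda_n(D)P_n\text{ for some }\Lambda_n(D)\in\operatorname{Mat}_N(\mathbb C),\ \forall n\ge0\}.$$ "Generated" means generated as an algebra over $\mathbb C$. *)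

theory Defs
  imports "HOL-Analysis.Analysis"
begin

type_synonym 'n cmat = "((complex, 'n) vec, 'n) vec"
type_synonym 'n mpoly = "((complex poly, 'n) vec, 'n) vec"

definition mpoly_eval :: "'n::finite mpoly \<Rightarrow> real \<Rightarrow> 'n cmat" where
  "mpoly_eval P x = map_matrix (\<lambda>p. poly p (of_real x)) P"

definition mpoly_coeff :: "'n::finite mpoly \<Rightarrow> nat \<Rightarrow> 'n cmat" where
  "mpoly_coeff P k = map_matrix (\<lambda>p. coeff p k) P"

definition mpoly_const :: "'n::finite cmat \<Rightarrow> 'n mpoly" where
  "mpoly_const A = map_matrix (\<lambda>c. [:c:]) A"

definition mpoly_deriv :: "'n::finite mpoly \<Rightarrow> 'n mpoly" where
  "mpoly_deriv P = map_matrix pderiv P"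

definition mpoly_scale :: "complex \<Rightarrow> 'n::finite mpoly \<Rightarrow> 'n mpoly" where
  "mpoly_scale c P = map_matrix (smult c) P"

definition conj_transpose :: "'n::finite cmat \<Rightarrow> 'n cmat" where
  "conj_transpose A = map_matrix cnj (transpose A)"

text \<open>The integral is the Bochner integral of a matrix-valued function, i.e. it is taken entrywise.\<close>

definition weight_inner ::
  "ereal \<Rightarrow> ereal \<Rightarrow> (real \<Rightarrow> 'n::finite cmat) \<Rightarrow> 'n mpoly \<Rightarrow> 'n mpoly \<Rightarrow> 'n cmat" where
  "weight_inner x0 x1 W P Q =
     (LBINT x=x0..x1. mpoly_eval P x ** W x ** conj_transpose (mpoly_eval Q x))"

definition monic_of_degree :: "nat \<Rightarrow> 'n::finite mpoly \<Rightarrow> bool" where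
  "monic_of_degree n P \<longleftrightarrow> mpoly_coeff P n = mat 1 \<and> (\<forall>k>n. mpoly_coeff P k = 0)"

definition is_monic_orthogonal ::
  "ereal \<Rightarrow> ereal \<Rightarrow> (real \<Rightarrow> 'n::finite cmat) \<Rightarrow> (nat \<Rightarrow> 'n mpoly) \<Rightarrow> bool" where
  "is_monic_orthogonal x0 x1 W P \<longleftrightarrow>
     (\<forall>n. monic_of_degree n (P n)) \<and>
     (\<forall>n m. n \<noteq> m \<longrightarrow> weight_inner x0 x1 W (P n) (P m) = 0)"

definition monic_orthogonal_polys ::
  "ereal \<Rightarrow> ereal \<Rightarrow> (real \<Rightarrow> 'n::finite cmat) \<Rightarrow> nat \<Rightarrow> 'n mpoly" where
  "monic_orthogonal_polys x0 x1 W = (THE P. is_monic_orthogonal x0 x1 W P)"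

text \<open>
  An operator is identified with its right action on matrix polynomials; \<open>diff_op [F\<^sub>0, \<dots>, F\<^sub>s]\<close>
  is the action \<open>P \<mapsto> \<Sum>i. P\<^sup>(\<^sup>i\<^sup>) F\<^sub>i\<close> of the operator \<open>\<Sum>i. \<partial>\<^sup>i F\<^sub>i\<close>. By
  \<open>diff_op_coeffs_unique\<close> below the action determines the coefficients up to
  trailing zeros of the list, so nothing is lost.
\<close>

type_synonym 'n mop = "'n mpoly \<Rightarrow> 'n mpoly"

definition diff_op :: "'n::finite mpoly list \<Rightarrow> 'n mop" where
  "diff_op Fs P = (\<Sum>i<length Fs. (mpoly_deriv ^^ i) P ** Fs ! i)"

definition matrix_diff_ops :: "'n::finite mop set" where
  "matrix_diff_ops = range diff_op"

text \<open>The operators act on the right: \<open>P \<cdot> (D\<^sub>1 D\<^sub>2) = (P \<cdot> D\<^sub>1) \<cdot> D\<^sub>2\<close>.\<close>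

definition mop_mult :: "'n::finite mop \<Rightarrow> 'n mop \<Rightarrow> 'n mop" where
  "mop_mult D\<^sub>1 D\<^sub>2 = (\<lambda>P. D\<^sub>2 (D\<^sub>1 P))"

definition mop_add :: "'n::finite mop \<Rightarrow> 'n mop \<Rightarrow> 'n mop" where
  "mop_add D\<^sub>1 D\<^sub>2 = (\<lambda>P. D\<^sub>1 P + D\<^sub>2 P)"

definition mop_scale :: "complex \<Rightarrow> 'n::finite mop \<Rightarrow> 'n mop" where
  "mop_scale c D = (\<lambda>P. mpoly_scale c (D P))"

definition mop_one :: "'n::finite mop" where
  "mop_one = diff_op [mat 1]"

inductive_set generated_algebra :: "'n::finite mop set \<Rightarrow> 'n mop set"
  for S :: "'n mop set" where
  gen: "D \<in> S \<Longrightarrow> D \<in> generated_algebra S"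
| zero: "(\<lambda>P. 0) \<in> generated_algebra S"
| add: "D \<in> generated_algebra S \<Longrightarrow> E \<in> generated_algebra S \<Longrightarrow> mop_add D E \<in> generated_algebra S"
| scale: "D \<in> generated_algebra S \<Longrightarrow> mop_scale c D \<in> generated_algebra S"
| mult: "D \<in> generated_algebra S \<Longrightarrow> E \<in> generated_algebra S \<Longrightarrow> mop_mult D E \<in> generated_algebra S"

definition weight_diff_algebra ::
  "ereal \<Rightarrow> ereal \<Rightarrow> (real \<Rightarrow> 'n::finite cmat) \<Rightarrow> 'n mop set" where
  "weight_diff_algebra x0 x1 W =
     {D \<in> matrix_diff_ops. \<forall>n. \<exists>\<Lambda> :: 'n cmat.
        D (monic_orthogonal_polys x0 x1 W n) =
          mpoly_const \<Lambda> ** monic_orthogonal_polys x0 x1 W n}"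

lemma funpow_mpoly_deriv_nth [simp]:
  "((mpoly_deriv ^^ i) P) $ r $ c = (pderiv ^^ i) (P $ r $ c)"
  by (induction i) (simp_all add: mpoly_deriv_def)

lemma pderiv_monom_pow:
  "(pderiv ^^ i) (monom (1::complex) k) = (if i \<le> k then monom (of_nat (fact k div fact (k - i))) (k - i) else 0)"
proof (induction i)
  case 0
  then show ?case by simp
next
  case (Suc i)
  show ?case
  proof (cases "Suc i \<le> k")
    case True
    then obtain d where d: "k = Suc i + d" using le_Suc_ex by blast
    have dv: "(fact d::nat) dvd fact k" "(fact (Suc d)::nat) dvd fact k"
      unfolding d by (intro fact_dvd; simp)+
    have "Suc d * (fact k div fact (Suc d)) = (fact k div fact d :: nat)"
    proof -
      obtain q where q: "fact k = fact (Suc d) * (q::nat)" using dv(2) by (auto simp: dvd_def)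
      have "fact k div fact (Suc d) = q" unfolding q by (rule nonzero_mult_div_cancel_left) simp
      moreover have "fact k div fact d = Suc d * q"
      proof -
        have "fact k = fact d * (Suc d * q)" unfolding q by (simp add: algebra_simps)
        then show ?thesis by (metis fact_nonzero nonzero_mult_div_cancel_left)
      qed
      ultimately show ?thesis by simp
    qed
    then have "of_nat (Suc d) * of_nat (fact k div fact (Suc d)) = (of_nat (fact k div fact d) :: complex)"
      by (metis of_nat_mult)
    moreover have "k - i = Suc d" "k - Suc i = d" "i \<le> k" using d by auto
    ultimately show ?thesis using Suc True by (simp add: pderiv_monom)
  next
    case False
    then show ?thesis using Suc by (auto simp: pderiv_monom)
  qed
qed

lemma diff_op_coeffs_unique:
  fixes Fs Gs :: "'n::finite mpoly list"
  assumes "diff_op Fs = diff_op Gs" and "length Fs = length Gs"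
  shows "Fs = Gs"
proof (rule nth_equalityI[OF assms(2)])
  have step: "diff_op Hs (map_matrix (\<lambda>p. p * monom 1 k) (mat 1)) $ r $ c =
      (\<Sum>i<length Hs. (pderiv ^^ i) (monom 1 k) * (Hs ! i) $ r $ c)"
    for Hs :: "'n mpoly list" and k r c
  proof -
    have z: "(pderiv ^^ i) (0::complex poly) = 0" for i by (induction i) auto
    have "((mpoly_deriv ^^ i) (map_matrix (\<lambda>p. p * monom 1 k) (mat 1)) ** (Hs ! i)) $ r $ c
        = (pderiv ^^ i) (monom 1 k) * (Hs ! i) $ r $ c" for i
    proof -
      have "((mpoly_deriv ^^ i) (map_matrix (\<lambda>p. p * monom 1 k) (mat 1)) ** (Hs ! i)) $ r $ c
          = (\<Sum>j\<in>UNIV. if r = j then (pderiv ^^ i) (monom 1 k) * (Hs ! i) $ r $ c else 0)"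
        unfolding matrix_matrix_mult_def vec_lambda_beta funpow_mpoly_deriv_nth nth_map_matrix mat_def
        by (intro sum.cong refl) (auto simp: z)
      then show ?thesis by simp
    qed
    then show ?thesis by (simp add: diff_op_def)
  qed
  have main: "k < length Fs \<Longrightarrow> Fs ! k = Gs ! k" for k
  proof (induction k rule: less_induct)
    case (less k)
    have "(Fs ! k) $ r $ c = (Gs ! k) $ r $ c" for r c
    proof -
      let ?t = "\<lambda>Hs i. (pderiv ^^ i) (monom 1 k) * ((Hs ! i) $ r $ c :: complex poly)"
      have split: "(\<Sum>i<length Fs. ?t Hs i) = (\<Sum>i<k. ?t Hs i) + ?t Hs k" for Hs :: "'n mpoly list"
      proof -
        have "(\<Sum>i<length Fs. ?t Hs i) = (\<Sum>i<Suc k. ?t Hs i)"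
          by (rule sum.mono_neutral_right) (use less.prems in \<open>auto simp: pderiv_monom_pow\<close>)
        then show ?thesis by simp
      qed
      have "(\<Sum>i<length Fs. ?t Fs i) = (\<Sum>i<length Fs. ?t Gs i)"
        using step[of Fs k r c] step[of Gs k r c] assms by simp
      moreover have "(\<Sum>i<k. ?t Fs i) = (\<Sum>i<k. ?t Gs i)"
        using less by (intro sum.cong) auto
      ultimately have "?t Fs k = ?t Gs k" using split by simp
      then show ?thesis by (simp add: pderiv_monom_pow)
    qed
    then show ?case by (simp add: vec_eq_iff)
  qed
  fix i assume "i < length Fs"
  then show "Fs ! i = Gs ! i" by (rule main)
qed

definition mat2 :: "'a::zero \<Rightarrow> 'a \<Rightarrow> 'a \<Rightarrow> 'a \<Rightarrow> 'a^2^2" where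
  "mat2 p q r s = vector [vector [p, q], vector [r, s]]"

abbreviation X :: "complex poly" where
  "X \<equiv> [:0, 1:]"

abbreviation C :: "real \<Rightarrow> complex poly" where
  "C r \<equiv> [:complex_of_real r:]"

definition W_lag :: "real \<Rightarrow> real \<Rightarrow> real \<Rightarrow> 2 cmat" where
  "W_lag \<alpha> a x = map_matrix (\<lambda>t. complex_of_real (exp (- x) * x powr \<alpha> * t))
     (mat2 (x * (1 + a^2 * x)) (a * x)
           (a * x)             1)"

definition D1 :: "real \<Rightarrow> real \<Rightarrow> 2 mop" where
  "D1 \<alpha> a = diff_op
    [mat2 (C (- (a^2 + 1) / a^2)) (C (a * (\<alpha> + 1)))
          0                       (C (- 1 / a^2)),
     mat2 (C (\<alpha> + 2) - X) (C a * X)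
          0               (C (\<alpha> + 1) - X),
     mat2 X 0
          0 X]"

definition D2 :: "real \<Rightarrow> real \<Rightarrow> 2 mop" where
  "D2 \<alpha> a = diff_op
    [mat2 (C ((a^2 + 1) / a^2)) (C (- ((a^2 + 1) * (\<alpha> + 1)) / a))
          0                     0,
     mat2 X           (- X * C ((a^2 * \<alpha> + 3 * a^2 + 1) / a))
          (C (1 / a)) (C (- \<alpha> - 1)),
     mat2 0 (- C a * X^2)
          0 (- X)]"

definition D3 :: "real \<Rightarrow> real \<Rightarrow> 2 mop" where
  "D3 \<alpha> a = diff_op
    [mat2 (C (- (\<alpha> + 1) / a)) (C ((\<alpha> + 1) * (a^2 * \<alpha> - 1) / a^2))
          (C (- 1 / a^2))     (C ((\<alpha> + 1) / a)),
     mat2 (C (1 / a) * (C (2 * (a^2 + 1) * (2 + \<alpha>)) - X))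
            (- C (1 / a^2) * X - C (2 * (a^2 * (\<alpha> + 2) + 1)) * X - C ((\<alpha> + 2) * (\<alpha> + 1)))
          (C (1 / a^2))
            (C (1 / a) * (X - C (2 * (\<alpha> + 1)))),
     mat2 (C (a * (\<alpha> + 5)) * X + C (2 / a) * X)
            (- C (a^2 * (\<alpha> + 5)) * X^2 - X * (C (2 * \<alpha>) + X + C 4))
          (C (2 + \<alpha>))
            (- C (a * (\<alpha> + 2)) * X - C (2 / a) * X),
     mat2 (C a * X^2) (- (X^2) * (C (a^2) * X + 1))
          X           (- C a * X^2)]"

end

theory Submission
  imports Defs
begin

text \<open>
  For suitable invertible matrices \<open>G\<^sub>n\<close>, affine in \<open>n\<close>, the entries of \<open>R\<^sub>n = G\<^sub>n P\<^sub>n\<close> are first order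
  differential expressions in the monic Laguerre polynomial \<open>q\<^sub>n\<close>. An operator \<open>D\<close> in \<open>D(W)\<close> is determined by the
  matrices \<open>\<Lambda>\<^sub>n\<close> with \<open>R\<^sub>n \<cdot> D = \<Lambda>\<^sub>n R\<^sub>n\<close>. Put \<open>t = n + 1 + 1/a\<^sup>2\<close> and \<open>s = n + 1/a\<^sup>2\<close>. The claim follows because
  the algebra generated by \<open>I\<close>, \<open>D\<^sub>1\<close>, \<open>D\<^sub>2\<close>, \<open>D\<^sub>3\<close> and \<open>D(W)\<close> both correspond to the matrices
  \<open>(\<lambda>(t), t (n + 1 + \<alpha>) f(t); s g(s), \<mu>(s))\<close> with polynomials satisfying \<open>\<lambda>(0) = \<mu>(0)\<close>. For the generated
  algebra this is a computation. For \<open>D(W)\<close>, comparing leading coefficients shows that \<open>\<Lambda>\<^sub>n\<close> is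
  conjugate under \<open>G\<^sub>n\<close> to a polynomial in \<open>n\<close>, which gives the first column and the polynomiality of
  \<open>\<mu>\<close>. After subtraction of generated operators only the second column \<open>(\<nu>(n), d)\<close> with a constant
  \<open>d\<close> remains, and here the finite order of \<open>D\<close> enters through the values of \<open>q\<^sub>n\<close> and its derivatives at \<open>0\<close>.
\<close>

section \<open>Monic Laguerre polynomials\<close>

text \<open>The polynomials (-1)^n n! L_n^(\<alpha>), built by the raising operator rather than the
  three-term recurrence, so that derivatives can be followed through the recursion.\<close>

fun lag :: "real \<Rightarrow> nat \<Rightarrow> complex poly" where
  "lag \<alpha> 0 = 1"
| "lag \<alpha> (Suc n) = X * (lag \<alpha> n - pderiv (lag \<alpha> n)) - C (real (Suc n) + \<alpha>) * lag \<alpha> n"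

text \<open>Both identities come from one induction: differentiating the recurrence and inserting
  the ODE for n gives the derivative formula for n, which in turn gives the ODE for n + 1.\<close>

lemma lag_ode:
  "X * pderiv (pderiv (lag \<alpha> n)) =
     (X - C (\<alpha> + 1)) * pderiv (lag \<alpha> n) - of_nat n * lag \<alpha> n"
  and pderiv_lag_Suc: "pderiv (lag \<alpha> (Suc n)) = of_nat (Suc n) * (lag \<alpha> n - pderiv (lag \<alpha> n))"
proof -
  \<comment> \<open>Opaque names let ring normalisation treat both polynomials as variables instead
    of expanding them.\<close>
  define x c where "x = X" and "c = C (\<alpha> + 1)"
  have x: "pderiv x = 1" and c: "pderiv c = 0"
    by (simp_all add: x_def c_def pderiv_pCons)
  have rec: "lag \<alpha> (Suc n) = x * (lag \<alpha> n - pderiv (lag \<alpha> n)) - (of_nat n + c) * lag \<alpha> n" for n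
    by (simp add: x_def c_def of_nat_poly algebra_simps)
  note [simp] = pderiv_mult pderiv_diff pderiv_add pderiv_of_nat x c
  have step: "pderiv (lag \<alpha> (Suc n)) = of_nat (Suc n) * (lag \<alpha> n - pderiv (lag \<alpha> n))"
    if "x * pderiv (pderiv (lag \<alpha> n)) = (x - c) * pderiv (lag \<alpha> n) - of_nat n * lag \<alpha> n" for n
    using that unfolding rec by (simp add: algebra_simps)
  have ode: "x * pderiv (pderiv (lag \<alpha> n)) = (x - c) * pderiv (lag \<alpha> n) - of_nat n * lag \<alpha> n" for n
  proof (induction n)
    case 0
    show ?case by simp
  next
    case (Suc n)
    let ?q = "lag \<alpha> n"
    have "x * pderiv (pderiv (lag \<alpha> (Suc n))) =
        of_nat (Suc n) * (x * pderiv ?q - x * pderiv (pderiv ?q))"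
      unfolding step[OF Suc] by (simp del: of_nat_Suc add: algebra_simps)
    also have "\<dots> = of_nat (Suc n) * (c * pderiv ?q + of_nat n * ?q)"
      unfolding Suc by (simp add: algebra_simps)
    also have "\<dots> = (x - c) * pderiv (lag \<alpha> (Suc n)) - of_nat (Suc n) * lag \<alpha> (Suc n)"
      unfolding step[OF Suc] unfolding rec by (simp add: algebra_simps)
    finally show ?case .
  qed
  show "X * pderiv (pderiv (lag \<alpha> n)) =
     (X - C (\<alpha> + 1)) * pderiv (lag \<alpha> n) - of_nat n * lag \<alpha> n"
    using ode unfolding x_def c_def .
  show "pderiv (lag \<alpha> (Suc n)) = of_nat (Suc n) * (lag \<alpha> n - pderiv (lag \<alpha> n))"
    by (rule step[OF ode])
qed

lemma coeff_lag: "coeff (lag \<alpha> n) n = 1" "k > n \<Longrightarrow> coeff (lag \<alpha> n) k = 0"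
proof -
  have "coeff (lag \<alpha> n) n = 1 \<and> (\<forall>k>n. coeff (lag \<alpha> n) k = 0)"
    by (induction n) (auto simp: coeff_pderiv coeff_pCons split: nat.splits)
  then show "coeff (lag \<alpha> n) n = 1" "k > n \<Longrightarrow> coeff (lag \<alpha> n) k = 0"
    by auto
qed

lemma coeff_lag_0: "coeff (lag \<alpha> (Suc n)) 0 = - of_real (real (Suc n) + \<alpha>) * coeff (lag \<alpha> n) 0"
  by (simp add: algebra_simps)

lemma coeff_lag_0_nonzero: "\<alpha> > -1 \<Longrightarrow> coeff (lag \<alpha> n) 0 \<noteq> 0"
proof (induction n)
  case (Suc n)
  have "real (Suc n) + \<alpha> \<noteq> 0"
    using Suc.prems by simp
  then show ?case
    using Suc by (simp only: coeff_lag_0) (simp del: of_nat_Suc of_real_add)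
qed simp

text \<open>The ODE is a two-term recurrence for the Taylor coefficients at 0.\<close>

lemma coeff_lag_taylor:
  assumes "\<alpha> > -1"
  shows "\<exists>g :: complex poly. \<forall>n. coeff (lag \<alpha> n) k = coeff (lag \<alpha> n) 0 * poly g (of_nat n)"
proof (induction k)
  case 0
  show ?case by (rule exI[of _ 1]) simp
next
  case (Suc k)
  then obtain g where g: "coeff (lag \<alpha> n) k = coeff (lag \<alpha> n) 0 * poly g (of_nat n)" for n
    by blast
  \<comment> \<open>Comparing coefficients of x^k in the ODE puts this factor in front of the
    coefficient of x^(k+1).\<close>
  define d :: complex where "d = of_nat (Suc k) * (of_nat (Suc k) + of_real \<alpha>)"
  have "real (Suc k) + \<alpha> \<noteq> 0"
    using assms by simp
  then have "complex_of_real (real (Suc k) + \<alpha>) \<noteq> 0"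
    unfolding of_real_eq_0_iff .
  then have d: "d \<noteq> 0"
    unfolding d_def by (simp del: of_nat_Suc)
  have "coeff (lag \<alpha> n) (Suc k) = coeff (lag \<alpha> n) 0 * poly (smult (inverse d) ([:of_nat k, -1:] * g)) (of_nat n)" for n
  proof -
    have "coeff (X * pderiv (pderiv (lag \<alpha> n))) k =
      coeff ((X - C (\<alpha> + 1)) * pderiv (lag \<alpha> n) - of_nat n * lag \<alpha> n) k"
      by (simp only: lag_ode)
    then have "d * coeff (lag \<alpha> n) (Suc k) = (of_nat k - of_nat n) * coeff (lag \<alpha> n) k"
      by (cases k) (simp_all add: coeff_pderiv algebra_simps of_nat_poly d_def eq_neg_iff_add_eq_0)
    then have "coeff (lag \<alpha> n) (Suc k) = inverse d * ((of_nat k - of_nat n) * coeff (lag \<alpha> n) k)"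
      using d by (simp add: field_simps)
    then show ?thesis
      by (simp add: g algebra_simps)
  qed
  then show ?case by blast
qed

section \<open>Integration against the Laguerre weight\<close>

definition wint :: "real \<Rightarrow> complex poly \<Rightarrow> complex" where
  "wint \<alpha> p = (LBINT x:{0<..}. complex_of_real (exp (- x) * x powr \<alpha>) * poly p (of_real x))"

lemma wint_monom_integral:
  assumes "\<alpha> > -1"
  shows "has_bochner_integral lborel
    (\<lambda>x. indicator {0<..} x *\<^sub>R (complex_of_real (exp (- x) * x powr \<alpha>) * poly (monom c k) (of_real x)))
    (c * of_real (Gamma (\<alpha> + 1 + real k)))"
proof -
  let ?f = "\<lambda>x::real. indicator {0<..} x * (exp (- x) * x powr (\<alpha> + real k))"
  have pos: "\<alpha> + 1 + real k > 0"
    using assms by simp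
  have "(\<integral>\<^sup>+x. ennreal (?f x) \<partial>lborel) = ennreal (Gamma (\<alpha> + 1 + real k))"
    unfolding Gamma_conv_nn_integral_real[OF pos]
    by (intro nn_integral_cong arg_cong[where f = ennreal])
       (auto simp: indicator_def exp_minus field_simps add.commute)
  moreover have "Gamma (\<alpha> + 1 + real k) \<ge> 0"
    using Gamma_real_pos[OF pos] by simp
  ultimately have "has_bochner_integral lborel ?f (Gamma (\<alpha> + 1 + real k))"
    by (intro has_bochner_integral_nn_integral) (auto simp: indicator_def)
  then have "has_bochner_integral lborel (\<lambda>x. c * complex_of_real (?f x))
      (c * of_real (Gamma (\<alpha> + 1 + real k)))"
    by (intro has_bochner_integral_mult_right has_bochner_integral_of_real)
  also have "(\<lambda>x. c * complex_of_real (?f x)) =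
    (\<lambda>x. indicator {0<..} x *\<^sub>R (complex_of_real (exp (- x) * x powr \<alpha>) * poly (monom c k) (of_real x)))"
    by (auto simp: indicator_def poly_monom powr_add powr_realpow fun_eq_iff)
  finally show ?thesis .
qed

text \<open>Finite sums of Gamma integrals. Integrability is recorded along with the value because
  the linearity rules for the integral require it.\<close>

lemma has_bochner_integral_wint:
  assumes "\<alpha> > -1"
  shows "has_bochner_integral lborel
    (\<lambda>x. indicator {0<..} x *\<^sub>R (complex_of_real (exp (- x) * x powr \<alpha>) * poly p (of_real x))) (wint \<alpha> p)"
proof -
  let ?w = "\<lambda>p x. indicator {0<..} x *\<^sub>R (complex_of_real (exp (- x) * x powr \<alpha>) * poly p (of_real x))"
  have "has_bochner_integral lborel (\<lambda>x. \<Sum>i\<le>degree p. ?w (monom (coeff p i) i) x)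
    (\<Sum>i\<le>degree p. coeff p i * of_real (Gamma (\<alpha> + 1 + real i)))"
    by (intro has_bochner_integral_sum wint_monom_integral assms)
  also have "(\<lambda>x. \<Sum>i\<le>degree p. ?w (monom (coeff p i) i) x) = ?w p"
  proof
    fix x
    have "poly p (complex_of_real x) = poly (\<Sum>i\<le>degree p. monom (coeff p i) i) (of_real x)"
      by (simp only: poly_as_sum_of_monoms)
    then show "(\<Sum>i\<le>degree p. ?w (monom (coeff p i) i) x) = ?w p x"
      by (simp add: poly_sum sum_distrib_left scaleR_right.sum)
  qed
  finally show ?thesis
    by (simp add: wint_def set_lebesgue_integral_def has_bochner_integral_iff)
qed

lemma wint_add: "\<alpha> > -1 \<Longrightarrow> wint \<alpha> (p + q) = wint \<alpha> p + wint \<alpha> q"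
  using has_bochner_integral_add[OF has_bochner_integral_wint[of \<alpha> p] has_bochner_integral_wint[of \<alpha> q]]
    has_bochner_integral_wint[of \<alpha> "p + q"]
  by (auto simp: algebra_simps dest: has_bochner_integral_eq)

lemma wint_smult: "\<alpha> > -1 \<Longrightarrow> wint \<alpha> (smult c p) = c * wint \<alpha> p"
  using has_bochner_integral_mult_right[OF has_bochner_integral_wint[of \<alpha> p], of c]
    has_bochner_integral_wint[of \<alpha> "smult c p"]
  by (auto simp: algebra_simps dest: has_bochner_integral_eq)

lemma wint_diff: "\<alpha> > -1 \<Longrightarrow> wint \<alpha> (p - q) = wint \<alpha> p - wint \<alpha> q"
  using wint_add[of \<alpha> p "smult (-1) q"] wint_smult[of \<alpha> "-1" q] by simp

lemma wint_of_nat_mult: "\<alpha> > -1 \<Longrightarrow> wint \<alpha> (of_nat n * p) = of_nat n * wint \<alpha> p"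
  by (simp add: of_nat_poly wint_smult)

lemma wint_monom: "\<alpha> > -1 \<Longrightarrow> wint \<alpha> (monom c k) = c * of_real (Gamma (\<alpha> + 1 + real k))"
  using wint_monom_integral has_bochner_integral_wint has_bochner_integral_eq by blast

text \<open>On monomials this is Gamma(s + 1) = s Gamma(s) with s = \<alpha> + 1 + k; linearity does
  the rest, so no boundary terms have to be discussed.\<close>

lemma wint_by_parts:
  assumes "\<alpha> > -1"
  shows "wint \<alpha> (X * pderiv p) = wint \<alpha> ((X - C (\<alpha> + 1)) * p)"
proof -
  have mon: "wint \<alpha> (X * pderiv (monom c k)) = wint \<alpha> ((X - C (\<alpha> + 1)) * monom c k)" for c k
  proof -
    have 1: "X * pderiv (monom c k) = monom (of_nat k * c) k"
      by (cases k) (simp_all add: pderiv_monom flip: monom_Suc)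
    have 2: "(X - C (\<alpha> + 1)) * monom c k = monom c (Suc k) - monom ((of_real \<alpha> + 1) * c) k"
      by (simp add: monom_Suc smult_monom algebra_simps smult_add_left add_monom)
    have "\<alpha> + 1 + real k \<noteq> 0"
      using assms by simp
    then have "Gamma (\<alpha> + 1 + real k + 1) = (\<alpha> + 1 + real k) * Gamma (\<alpha> + 1 + real k)"
      by (intro Gamma_plus1) (use assms in \<open>auto elim!: nonpos_Ints_cases'\<close>)
    then have "Gamma (\<alpha> + 1 + real (Suc k)) = (\<alpha> + 1 + real k) * Gamma (\<alpha> + 1 + real k)"
      by (simp add: add_ac)
    then show ?thesis
      unfolding 1 2 wint_diff[OF assms] wint_monom[OF assms]
      by (simp add: algebra_simps)
  qed
  have "wint \<alpha> (X * pderiv (\<Sum>i\<in>A. monom (c i) i)) =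
      wint \<alpha> ((X - C (\<alpha> + 1)) * (\<Sum>i\<in>A. monom (c i) i))" if "finite A" for A c
    using that
    by induction (simp_all only: not_False_eq_True sum.insert sum.empty pderiv_add pderiv_0 mult_zero_right
        distrib_left wint_add[OF assms] mon)
  from this[of "{..degree p}" "coeff p"] show ?thesis
    by (simp only: poly_as_sum_of_monoms finite_atMost)
qed

text \<open>Integration by parts for q_n' v, with q_n'' removed by the ODE. This is the symmetric
  form of the Laguerre operator, with eigenvalue n.\<close>

lemma wint_lag_deriv:
  assumes "\<alpha> > -1"
  shows "wint \<alpha> (X * pderiv (lag \<alpha> n) * pderiv v) = of_nat n * wint \<alpha> (lag \<alpha> n * v)"
proof -
  define x c where "x = X" and "c = C (\<alpha> + 1)"
  let ?q = "lag \<alpha> n"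
  have "wint \<alpha> (x * pderiv (pderiv ?q * v)) = wint \<alpha> ((x - c) * (pderiv ?q * v))"
    unfolding x_def c_def by (rule wint_by_parts[OF assms])
  also have "x * pderiv (pderiv ?q * v) = x * pderiv ?q * pderiv v + (x * pderiv (pderiv ?q)) * v"
    by (simp add: pderiv_mult algebra_simps)
  also have "x * pderiv (pderiv ?q) = (x - c) * pderiv ?q - of_nat n * ?q"
    unfolding x_def c_def by (rule lag_ode)
  also have "x * pderiv ?q * pderiv v + ((x - c) * pderiv ?q - of_nat n * ?q) * v
     = x * pderiv ?q * pderiv v + ((x - c) * (pderiv ?q * v) - of_nat n * (?q * v))"
    by (simp add: algebra_simps)
  finally show ?thesis
    by (simp only: x_def wint_add[OF assms] wint_diff[OF assms] wint_of_nat_mult[OF assms]) simp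
qed

text \<open>For v = q_m the left side of \<open>wint_lag_deriv\<close> is symmetric in n and m, and
  distinct eigenvalues force the integral to vanish.\<close>

lemma wint_lag_orthogonal:
  assumes "\<alpha> > -1" "n \<noteq> m"
  shows "wint \<alpha> (lag \<alpha> n * lag \<alpha> m) = 0"
proof -
  have "of_nat n * wint \<alpha> (lag \<alpha> n * lag \<alpha> m) = of_nat m * wint \<alpha> (lag \<alpha> n * lag \<alpha> m)"
    using wint_lag_deriv[OF assms(1), of n "lag \<alpha> m"] wint_lag_deriv[OF assms(1), of m "lag \<alpha> n"]
    by (simp only: mult.commute mult.left_commute)
  then show ?thesis
    using assms(2) by simp
qed

text \<open>One factor q_{n+1} is written as raised from q_n; by parts the derivative moves to the
  other factor, where it lowers the index again.\<close>

lemma wint_lag_square_Suc: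
  assumes "\<alpha> > -1"
  shows "wint \<alpha> (lag \<alpha> (Suc n) * lag \<alpha> (Suc n)) =
    of_nat (Suc n) * of_real (real (Suc n) + \<alpha>) * wint \<alpha> (lag \<alpha> n * lag \<alpha> n)"
proof -
  define x c d where "x = X" and "c = C (\<alpha> + 1)" and "d = complex_of_real (real (Suc n) + \<alpha>)"
  let ?q = "lag \<alpha> n" and ?v = "lag \<alpha> (Suc n)"
  have d: "smult d p = of_nat n * p + c * p" for p
    by (simp add: d_def c_def of_nat_poly smult_add_left algebra_simps)
  have v: "?v = x * (?q - pderiv ?q) - smult d ?q"
    by (simp add: x_def d_def)
  \<comment> \<open>The total derivative x (q w)' is split off because its integral cancels that of
    (x - c) q w. For w = q_{n+1} the last term vanishes by orthogonality.\<close>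
  have "?v * w = (x - c) * (?q * w) + x * ?q * pderiv w - x * pderiv (?q * w) - of_nat n * (?q * w)" for w
    unfolding v d pderiv_mult by (simp only: algebra_simps)
  from this[of ?v] have "?v * ?v =
      (x - c) * (?q * ?v) + x * ?q * pderiv ?v - x * pderiv (?q * ?v) - of_nat n * (?q * ?v)" .
  also have "x * ?q * pderiv ?v = of_nat (Suc n) * (?q * (x * (?q - pderiv ?q)))"
    unfolding pderiv_lag_Suc by (simp only: mult_ac)
  also have "x * (?q - pderiv ?q) = ?v + smult d ?q"
    using v by simp
  also have "?q * (?v + smult d ?q) = ?q * ?v + smult d (?q * ?q)"
    by (simp only: algebra_simps mult_smult_right)
  finally show ?thesis
    using wint_by_parts[OF assms, of "?q * ?v"] wint_lag_orthogonal[OF assms, of n "Suc n"]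
    by (simp only: wint_add[OF assms] wint_diff[OF assms] wint_of_nat_mult[OF assms]
        wint_smult[OF assms] x_def c_def d_def) simp
qed

lemma wint_lag_square_pos:
  assumes "\<alpha> > -1"
  shows "\<exists>h>0. wint \<alpha> (lag \<alpha> n * lag \<alpha> n) = of_real h"
proof (induction n)
  case 0
  have "wint \<alpha> 1 = of_real (Gamma (\<alpha> + 1))"
    using wint_monom[OF assms, of 1 0] by simp
  moreover have "Gamma (\<alpha> + 1) > 0"
    using assms by (intro Gamma_real_pos) simp
  ultimately show ?case by auto
next
  case (Suc n)
  then obtain h where "h > 0" "wint \<alpha> (lag \<alpha> n * lag \<alpha> n) = of_real h" by blast
  then show ?case
    unfolding wint_lag_square_Suc[OF assms] using assms
    by (intro exI[of _ "real (Suc n) * (real (Suc n) + \<alpha>) * h"]) (auto intro!: mult_pos_pos)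
qed

section \<open>Matrix polynomials and differential operators\<close>

lemma mpoly_const_mult: "mpoly_const (A ** B) = mpoly_const A ** mpoly_const B"
proof -
  have "[:\<Sum>k\<in>S. f k:] = (\<Sum>k\<in>S. [:f k:])" for S :: "'a set" and f :: "'a \<Rightarrow> complex"
    by (rule poly_eqI) (simp add: coeff_sum coeff_pCons split: nat.splits)
  then show ?thesis
    by (simp add: vec_eq_iff mpoly_const_def matrix_matrix_mult_def mult.commute)
qed

lemma mpoly_const_add: "mpoly_const (A + B) = mpoly_const A + mpoly_const B"
  by (simp add: vec_eq_iff mpoly_const_def)

lemma mpoly_const_0 [simp]: "mpoly_const 0 = 0"
  by (simp add: vec_eq_iff mpoly_const_def)

lemma mpoly_const_mat_1 [simp]: "mpoly_const (mat 1) = mat 1"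
  by (simp add: vec_eq_iff mpoly_const_def mat_def)

lemma mpoly_const_mult_nth: "(mpoly_const A ** P) $ i $ j = (\<Sum>k\<in>UNIV. smult (A $ i $ k) (P $ k $ j))"
  by (simp add: mpoly_const_def matrix_matrix_mult_def)

lemma mpoly_scale_eq: "mpoly_scale c P = mpoly_const (mat c) ** P"
  unfolding vec_eq_iff mpoly_const_mult_nth
  by (simp add: mpoly_scale_def mat_def if_distrib[of "\<lambda>c. smult c _"] cong: if_cong)

lemma mpoly_scale_eq_right: "mpoly_scale c P = P ** mpoly_const (mat c)"
  by (simp add: vec_eq_iff mpoly_scale_def mpoly_const_def mat_def matrix_matrix_mult_def
    if_distrib[of "\<lambda>c. smult c _"] cong: if_cong)

lemma mpoly_coeff_add: "mpoly_coeff (P + Q) k = mpoly_coeff P k + mpoly_coeff Q k"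
  and mpoly_coeff_diff: "mpoly_coeff (P - Q) k = mpoly_coeff P k - mpoly_coeff Q k"
  and mpoly_coeff_0 [simp]: "mpoly_coeff 0 k = 0"
  by (simp_all add: vec_eq_iff mpoly_coeff_def)

lemma mpoly_coeff_sum: "mpoly_coeff (\<Sum>x\<in>S. f x) k = (\<Sum>x\<in>S. mpoly_coeff (f x) k)"
  by (induction S rule: infinite_finite_induct) (simp_all add: mpoly_coeff_add)

lemma mpoly_coeff_const_mult: "mpoly_coeff (mpoly_const A ** P) k = A ** mpoly_coeff P k"
  unfolding vec_eq_iff mpoly_coeff_def nth_map_matrix mpoly_const_mult_nth
  by (simp add: coeff_sum matrix_matrix_mult_def)

lemma mpoly_eqI: "(\<And>k. mpoly_coeff P k = mpoly_coeff Q k) \<Longrightarrow> P = Q"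
  by (simp add: vec_eq_iff mpoly_coeff_def poly_eq_iff)

lemma mpoly_deriv_add: "mpoly_deriv (P + Q) = mpoly_deriv P + mpoly_deriv Q"
  by (simp add: vec_eq_iff mpoly_deriv_def pderiv_add)

lemma mpoly_deriv_0 [simp]: "mpoly_deriv 0 = 0"
  by (simp add: vec_eq_iff mpoly_deriv_def)

lemma mpoly_deriv_sum: "mpoly_deriv (\<Sum>x\<in>S. f x) = (\<Sum>x\<in>S. mpoly_deriv (f x))"
  by (induction S rule: infinite_finite_induct) (simp_all add: mpoly_deriv_add)

lemma mpoly_deriv_mult: "mpoly_deriv (P ** Q) = mpoly_deriv P ** Q + P ** mpoly_deriv Q"
proof -
  have "pderiv (sum f S) = (\<Sum>x\<in>S. pderiv (f x))" for f :: "'a \<Rightarrow> complex poly" and S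
    using higher_pderiv_sum[of 1 f S] by simp
  then show ?thesis
    by (simp add: vec_eq_iff mpoly_deriv_def matrix_matrix_mult_def pderiv_mult sum.distrib algebra_simps)
qed

lemma matrix_mult_add_left: "(A + B) ** P = A ** P + B ** (P :: 'a::comm_ring_1^'n^'n)"
  by (simp add: vec_eq_iff matrix_matrix_mult_def algebra_simps sum.distrib)

lemma matrix_mult_sum_left: "(\<Sum>x\<in>S. f x) ** (B :: 'a::comm_ring_1^'n^'n) = (\<Sum>x\<in>S. f x ** B)"
  by (induction S rule: infinite_finite_induct) (simp_all add: matrix_mult_add_left)

lemma matrix_mult_sum_right: "(B :: 'a::comm_ring_1^'n^'n) ** (\<Sum>x\<in>S. f x) = (\<Sum>x\<in>S. B ** f x)"
  by (induction S rule: infinite_finite_induct) (simp_all add: matrix_add_ldistrib)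

text \<open>Operators acting on the right commute with constant matrices on the left, so Mat_N(C)
  serves as the ring of scalars.\<close>

definition left_linear :: "'n::finite mop \<Rightarrow> bool" where
  "left_linear D \<longleftrightarrow> (\<forall>P Q. D (P + Q) = D P + D Q) \<and>
     (\<forall>A P. D (mpoly_const A ** P) = mpoly_const A ** D P)"

lemma left_linear_add: "left_linear D \<Longrightarrow> D (P + Q) = D P + D Q"
  and left_linear_const: "left_linear D \<Longrightarrow> D (mpoly_const A ** P) = mpoly_const A ** D P"
  by (simp_all add: left_linear_def)

lemma left_linear_0: "left_linear D \<Longrightarrow> D 0 = 0"
  using left_linear_const[of D 0 0] by simp

lemma left_linear_sum: "left_linear D \<Longrightarrow> D (\<Sum>x\<in>S. f x) = (\<Sum>x\<in>S. D (f x))"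
  by (induction S rule: infinite_finite_induct) (simp_all add: left_linear_0 left_linear_add)

section \<open>Closure of the differential operators under sums and products\<close>

lemma diff_op_nth:
  "diff_op Fs P $ i $ j = (\<Sum>k<length Fs. \<Sum>l\<in>UNIV. (pderiv ^^ k) (P $ i $ l) * (Fs ! k) $ l $ j)"
  by (simp add: diff_op_def matrix_matrix_mult_def)

lemma left_linear_diff_op: "D \<in> matrix_diff_ops \<Longrightarrow> left_linear D"
proof -
  have "(mpoly_deriv ^^ k) (P + Q) = (mpoly_deriv ^^ k) P + (mpoly_deriv ^^ k) Q" for k and P Q :: "'a mpoly"
    by (simp add: vec_eq_iff higher_pderiv_add)
  moreover have "(mpoly_deriv ^^ k) (mpoly_const A ** P) = mpoly_const A ** (mpoly_deriv ^^ k) P"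
    for k and A and P :: "'a mpoly"
    by (simp add: vec_eq_iff mpoly_const_mult_nth higher_pderiv_sum higher_pderiv_smult)
  ultimately show "D \<in> matrix_diff_ops \<Longrightarrow> left_linear D"
    by (auto simp: matrix_diff_ops_def left_linear_def diff_op_def matrix_mult_add_left sum.distrib
        matrix_mult_sum_right matrix_mul_assoc)
qed

lemma diff_op_single: "(\<lambda>P. (mpoly_deriv ^^ i) P ** F) \<in> matrix_diff_ops"
proof -
  have "diff_op (replicate i 0 @ [F]) P = (mpoly_deriv ^^ i) P ** F" for P
    by (simp add: diff_op_def nth_append)
  then show ?thesis
    unfolding matrix_diff_ops_def by (metis (no_types, lifting) rangeI ext)
qed

lemma matrix_diff_ops_add:
  assumes "D \<in> matrix_diff_ops" "E \<in> matrix_diff_ops"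
  shows "(\<lambda>P. D P + E P) \<in> matrix_diff_ops"
proof -
  obtain Fs Gs where D: "D = diff_op Fs" and E: "E = diff_op Gs"
    using assms by (auto simp: matrix_diff_ops_def)
  define N where "N = max (length Fs) (length Gs)"
  define pad where "pad Hs = Hs @ replicate (N - length Hs) 0" for Hs :: "'a mpoly list"
  have pad: "diff_op Hs P = (\<Sum>i<N. (mpoly_deriv ^^ i) P ** pad Hs ! i)" if "length Hs \<le> N" for Hs P
    unfolding diff_op_def by (rule sum.mono_neutral_cong_left) (use that in \<open>auto simp: pad_def nth_append\<close>)
  have "diff_op (map (\<lambda>i. pad Fs ! i + pad Gs ! i) [0..<N]) P = D P + E P" for P
    using pad[of Fs] pad[of Gs]
    by (simp add: D E diff_op_def[of "map _ _"] N_def matrix_add_ldistrib sum.distrib)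
  then show ?thesis
    unfolding matrix_diff_ops_def by (metis (no_types, lifting) rangeI ext)
qed

lemma matrix_diff_ops_0: "(\<lambda>P. 0) \<in> matrix_diff_ops"
  unfolding matrix_diff_ops_def
  by (rule range_eqI[of _ _ "[]"]) (simp add: diff_op_def fun_eq_iff)

lemma matrix_diff_ops_sum:
  assumes "finite S" and "\<And>x. x \<in> S \<Longrightarrow> D x \<in> matrix_diff_ops"
  shows "(\<lambda>P. \<Sum>x\<in>S. D x P) \<in> matrix_diff_ops"
  using assms by induction (simp_all add: matrix_diff_ops_0 matrix_diff_ops_add)

lemma matrix_diff_ops_mult_right:
  assumes "D \<in> matrix_diff_ops"
  shows "(\<lambda>P. D P ** G) \<in> matrix_diff_ops"
proof -
  obtain Fs where D: "D = diff_op Fs"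
    using assms by (auto simp: matrix_diff_ops_def)
  have "(\<lambda>P. \<Sum>i<length Fs. (mpoly_deriv ^^ i) P ** (Fs ! i ** G)) \<in> matrix_diff_ops"
    by (intro matrix_diff_ops_sum diff_op_single finite_lessThan)
  then show ?thesis
    by (simp add: D diff_op_def matrix_mult_sum_left matrix_mul_assoc)
qed

lemma matrix_diff_ops_deriv:
  assumes "D \<in> matrix_diff_ops"
  shows "(\<lambda>P. mpoly_deriv (D P)) \<in> matrix_diff_ops"
proof -
  obtain Fs where D: "D = diff_op Fs"
    using assms by (auto simp: matrix_diff_ops_def)
  have "(\<lambda>P. \<Sum>i<length Fs. (mpoly_deriv ^^ Suc i) P ** Fs ! i + (mpoly_deriv ^^ i) P ** mpoly_deriv (Fs ! i))
      \<in> matrix_diff_ops"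
    by (intro matrix_diff_ops_sum matrix_diff_ops_add diff_op_single finite_lessThan)
  then show ?thesis
    by (simp add: D diff_op_def mpoly_deriv_sum mpoly_deriv_mult)
qed

text \<open>The product applies the derivatives in E to D P and multiplies by coefficients on the
  right; closure under differentiation is the Leibniz rule of
  \<open>matrix_diff_ops_deriv\<close>.\<close>

lemma matrix_diff_ops_mult:
  assumes "D \<in> matrix_diff_ops" "E \<in> matrix_diff_ops"
  shows "mop_mult D E \<in> matrix_diff_ops"
proof -
  obtain Gs where E: "E = diff_op Gs"
    using assms by (auto simp: matrix_diff_ops_def)
  have "(\<lambda>P. (mpoly_deriv ^^ i) (D P)) \<in> matrix_diff_ops" for i
    by (induction i) (use assms matrix_diff_ops_deriv in auto)
  then have "(\<lambda>P. \<Sum>i<length Gs. (mpoly_deriv ^^ i) (D P) ** Gs ! i) \<in> matrix_diff_ops"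
    by (intro matrix_diff_ops_sum matrix_diff_ops_mult_right finite_lessThan)
  then show ?thesis
    by (simp add: mop_mult_def E diff_op_def)
qed

lemma matrix_diff_ops_scale: "D \<in> matrix_diff_ops \<Longrightarrow> mop_scale c D \<in> matrix_diff_ops"
  unfolding mop_scale_def mpoly_scale_eq_right by (rule matrix_diff_ops_mult_right)

section \<open>Degree-preserving operators and their action on leading coefficients\<close>

fun ffact_poly :: "nat \<Rightarrow> complex poly" where
  "ffact_poly 0 = 1"
| "ffact_poly (Suc k) = ffact_poly k * [:- of_nat k, 1:]"

lemma ffact_poly_eq_0: "n < k \<Longrightarrow> poly (ffact_poly k) (of_nat n) = 0"
proof (induction k)
  case (Suc k)
  then show ?case by (cases "n = k") auto
qed simp

text \<open>For k > n the truncated exponent n - k does no harm, since the falling factorial n (n -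
  1) ... (n - k + 1) vanishes.\<close>

lemma higher_pderiv_monom_ffact:
  "(pderiv ^^ k) (monom c n) = monom (poly (ffact_poly k) (of_nat n) * c) (n - k)"
proof (induction k)
  case (Suc k)
  then show ?case
    by (cases "k \<le> n") (auto simp: pderiv_monom algebra_simps of_nat_diff ffact_poly_eq_0)
qed simp

text \<open>The derivative of order k reaches the top coefficient only through the coefficient of
  x^k in \<open>f k\<close>, times a falling factorial in n; the finite sum of these is polynomial
  in n.\<close>

lemma coeff_degree_preserving_op:
  fixes f :: "nat \<Rightarrow> complex poly" and N :: nat
  defines "A \<equiv> (\<lambda>p. \<Sum>k<N. (pderiv ^^ k) p * f k)"
  assumes deg: "\<And>p. degree (A p) \<le> degree p"
  shows "\<exists>g. \<forall>p n. degree p \<le> n \<longrightarrow> coeff (A p) n = coeff p n * poly g (of_nat n)"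
proof (intro exI allI impI)
  fix p :: "complex poly" and n
  assume p: "degree p \<le> n"
  have A0: "A 0 = 0"
    by (simp add: A_def)
  define r where "r = p - monom (coeff p n) n"
  have "A p = A (monom (coeff p n) n) + A r"
    unfolding A_def sum.distrib[symmetric] distrib_right[symmetric] higher_pderiv_add[symmetric]
    by (simp add: r_def)
  moreover have "coeff (A r) n = 0"
  \<comment> \<open>The zero polynomial has degree 0, which is not below n = 0, so it is treated
    apart.\<close>
  proof (cases "r = 0")
    case False
    have "degree r \<le> n"
      using p by (auto simp: r_def intro!: degree_diff_le order.trans[OF degree_monom_le])
    moreover have "degree r \<noteq> n"
    proof
      assume "degree r = n"
      then have "coeff r n \<noteq> 0" using False by auto
      then show False by (simp add: r_def)
    qed
    ultimately show ?thesis
      using deg[of r] by (intro coeff_eq_0) linarith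
  qed (simp add: A0)
  moreover have "coeff ((pderiv ^^ k) (monom (coeff p n) n) * f k) n =
      coeff p n * poly (smult (coeff (f k) k) (ffact_poly k)) (of_nat n)" for k
    by (cases "k \<le> n") (auto simp: higher_pderiv_monom_ffact coeff_monom_mult ffact_poly_eq_0)
  ultimately show "coeff (A p) n =
      coeff p n * poly (\<Sum>k<N. smult (coeff (f k) k) (ffact_poly k)) (of_nat n)"
    by (simp add: A_def coeff_sum poly_sum sum_distrib_left)
qed

text \<open>Degrees may drop; only an increase is excluded.\<close>

definition degree_preserving :: "'n::finite mop \<Rightarrow> bool" where
  "degree_preserving D \<longleftrightarrow> (\<forall>P n. (\<forall>k>n. mpoly_coeff P k = 0) \<longrightarrow> (\<forall>k>n. mpoly_coeff (D P) k = 0))"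

lemma mpoly_coeff_eq_0_iff: "(\<forall>k>n. mpoly_coeff P k = 0) \<longleftrightarrow> (\<forall>i j. degree (P $ i $ j) \<le> n)"
proof -
  have "(\<forall>k>n. coeff p k = 0) \<longleftrightarrow> degree p \<le> n" for p :: "complex poly"
    by (meson coeff_eq_0 degree_le le_less_trans)
  then show ?thesis
    by (auto simp: mpoly_coeff_def vec_eq_iff)
qed

lemma mpoly_coeff_degree_preserving:
  fixes D :: "'n::finite mop"
  assumes D: "D \<in> matrix_diff_ops" "degree_preserving D"
  shows "\<exists>K :: 'n mpoly. \<forall>P n. (\<forall>k>n. mpoly_coeff P k = 0) \<longrightarrow>
    mpoly_coeff (D P) n = mpoly_coeff P n ** mpoly_eval K (real n)"
proof -
  obtain Fs where Fs: "D = diff_op Fs"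
    using D by (auto simp: matrix_diff_ops_def)
  define A where "A l j p = (\<Sum>k<length Fs. (pderiv ^^ k) p * (Fs ! k) $ l $ j)" for l j p
  have D_nth: "D P $ i $ j = (\<Sum>l\<in>UNIV. A l j (P $ i $ l))" for P i j
    unfolding Fs diff_op_nth A_def by (rule sum.swap)
  have A0: "A l j 0 = 0" for l j
    by (simp add: A_def)
  have "degree (A l j p) \<le> degree p" for l j p
  proof -
    \<comment> \<open>Filling column l with p isolates the scalar operator in position (l,
      j).\<close>
    define P :: "'n mpoly" where "P = (\<chi> r c. if c = l then p else 0)"
    have "\<forall>i j. degree (D P $ i $ j) \<le> degree p"
      using D(2) unfolding degree_preserving_def mpoly_coeff_eq_0_iff
      by (simp add: P_def)
    moreover have "D P $ l $ j = A l j p"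
      unfolding D_nth P_def by (simp add: if_distrib[of "A _ _"] A0 cong: if_cong)
    ultimately show ?thesis by metis
  qed
  then have "\<exists>g. \<forall>p n. degree p \<le> n \<longrightarrow> coeff (A l j p) n = coeff p n * poly g (of_nat n)" for l j
    unfolding A_def by (rule coeff_degree_preserving_op)
  then obtain g where g: "degree p \<le> n \<Longrightarrow> coeff (A l j p) n = coeff p n * poly (g l j) (of_nat n)" for l j p n
    by metis
  show ?thesis
    unfolding mpoly_coeff_eq_0_iff
  proof (intro exI[of _ "\<chi> l j. g l j"] allI impI)
    fix P :: "'n mpoly" and n
    assume "\<forall>i j. degree (P $ i $ j) \<le> n"
    then have "coeff (A l j (P $ i $ l)) n = coeff (P $ i $ l) n * poly (g l j) (of_nat n)" for i j l
      by (intro g) simp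
    then show "mpoly_coeff (D P) n = mpoly_coeff P n ** mpoly_eval (\<chi> l j. g l j) (real n)"
      by (simp add: mpoly_coeff_def mpoly_eval_def vec_eq_iff D_nth matrix_matrix_mult_def coeff_sum)
  qed
qed

section \<open>Bases over constant left factors with one matrix polynomial in each degree\<close>

definition graded_basis :: "(nat \<Rightarrow> 'n::finite mpoly) \<Rightarrow> bool" where
  "graded_basis R \<longleftrightarrow>
     (\<forall>n. invertible (mpoly_coeff (R n) n) \<and> (\<forall>k>n. mpoly_coeff (R n) k = 0))"

text \<open>Elimination from the top: the invertible leading coefficient of \<open>R n\<close>
  allows a constant left multiple of it to cancel the coefficient of x^n.\<close>

lemma graded_basis_expand:
  assumes "graded_basis R" and "\<forall>k\<ge>n. mpoly_coeff P k = 0"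
  shows "\<exists>A. P = (\<Sum>k<n. mpoly_const (A k) ** R k)"
  using assms(2)
proof (induction n arbitrary: P)
  case 0
  then have "P = 0" by (intro mpoly_eqI) simp
  then show ?case by simp
next
  case (Suc n)
  obtain G where G: "G ** mpoly_coeff (R n) n = mat 1" and R: "\<forall>k>n. mpoly_coeff (R n) k = 0"
    using assms(1) by (auto simp: graded_basis_def invertible_def)
  define B where "B = mpoly_coeff P n ** G"
  have "B ** mpoly_coeff (R n) n = mpoly_coeff P n"
    using G by (simp add: B_def flip: matrix_mul_assoc)
  then have "mpoly_coeff (P - mpoly_const B ** R n) k = 0" if "k \<ge> n" for k
    using R Suc.prems that by (cases "k = n") (auto simp: mpoly_coeff_diff mpoly_coeff_const_mult)
  then obtain A where "P - mpoly_const B ** R n = (\<Sum>k<n. mpoly_const (A k) ** R k)"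
    using Suc.IH by blast
  then have "P = (\<Sum>k<Suc n. mpoly_const ((A(n := B)) k) ** R k)"
    by (simp add: algebra_simps)
  then show ?case by blast
qed

lemma mpoly_coeff_bounded: "\<exists>n. \<forall>k\<ge>n. mpoly_coeff (P :: 'n::finite mpoly) k = 0"
proof -
  define n where "n = Max (range (\<lambda>(i, j). degree (P $ i $ j)))"
  have "degree (P $ i $ j) \<le> n" for i j
    unfolding n_def by (rule Max_ge) (auto intro!: image_eqI[of _ _ "(i, j)"])
  then show ?thesis
    using mpoly_coeff_eq_0_iff[of n P] by (intro exI[of _ "Suc n"]) (simp add: Suc_le_eq)
qed

text \<open>The \<open>R n\<close> span all matrix polynomials over constant left factors, so
  eigenvalue matrices determine an operator.\<close>

lemma left_linear_eqI:
  fixes R :: "nat \<Rightarrow> 'n::finite mpoly"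
  assumes "graded_basis R" "left_linear D" "left_linear E" "\<And>n. D (R n) = E (R n)"
  shows "D = E"
proof
  fix P :: "'n mpoly"
  obtain n where "\<forall>k\<ge>n. mpoly_coeff P k = 0"
    using mpoly_coeff_bounded by blast
  then obtain A where "P = (\<Sum>k<n. mpoly_const (A k) ** R k)"
    using graded_basis_expand[OF assms(1)] by blast
  then show "D P = E P"
    by (simp add: left_linear_sum left_linear_const assms)
qed

lemma degree_preservingI:
  fixes R :: "nat \<Rightarrow> 'n::finite mpoly"
  assumes R: "graded_basis R" and D: "left_linear D"
    and eig: "\<And>n. D (R n) = mpoly_const (\<Lambda> n) ** R n"
  shows "degree_preserving D"
  unfolding degree_preserving_def
proof (intro allI impI)
  fix P :: "'n mpoly" and n m
  assume "\<forall>k>n. mpoly_coeff P k = 0" and m: "m > n"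
  then obtain A where "P = (\<Sum>k<Suc n. mpoly_const (A k) ** R k)"
    using graded_basis_expand[OF R, of "Suc n" P] by (auto simp: Suc_le_eq)
  moreover have "mpoly_coeff (R k) m = 0" if "k < Suc n" for k
    using R that m by (simp add: graded_basis_def)
  ultimately show "mpoly_coeff (D P) m = 0"
    by (simp add: left_linear_sum[OF D] left_linear_const[OF D] eig mpoly_coeff_sum mpoly_coeff_const_mult
        del: sum.lessThan_Suc)
qed

section \<open>The orthogonal polynomials of the weight\<close>

lemma mat2_nth [simp]:
  "mat2 p q r s $ 1 $ 1 = p" "mat2 p q r s $ 1 $ 2 = q"
  "mat2 p q r s $ 2 $ 1 = r" "mat2 p q r s $ 2 $ 2 = s"
  by (simp_all add: mat2_def)

lemma mat2_eq_iff: "P = Q \<longleftrightarrow> P $ 1 $ 1 = Q $ 1 $ 1 \<and> P $ 1 $ 2 = Q $ 1 $ 2 \<and>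
    P $ 2 $ 1 = Q $ 2 $ 1 \<and> P $ 2 $ 2 = Q $ 2 $ 2" for P Q :: "'a^2^2"
  by (simp add: vec_eq_iff forall_2)

lemma matrix_mult_nth_2: "(P ** Q) $ i $ j = P $ i $ 1 * Q $ 1 $ j + P $ i $ 2 * Q $ 2 $ j"
  for P Q :: "'a::semiring_1^2^2"
  by (simp add: matrix_matrix_mult_def sum_2)

lemma mpoly_const_nth [simp]: "mpoly_const A $ i $ j = [:A $ i $ j:]"
  by (simp add: mpoly_const_def)

lemma mpoly_coeff_nth [simp]: "mpoly_coeff P k $ i $ j = coeff (P $ i $ j) k"
  by (simp add: mpoly_coeff_def)

text \<open>
  The monic orthogonal polynomials of \<open>W\<close> up to a constant left factor. With \<open>q\<^sub>n\<close> the monic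
  Laguerre polynomial and \<open>T = (1, ax; 0, 1)\<close>, so that \<open>W = e\<^sup>-\<^sup>x x\<^sup>\<alpha> T diag(x, 1) T\<^sup>*\<close>, the rows
  multiplied by \<open>T\<close> are \<open>(q\<^sub>n - q\<^sub>n', a q\<^sub>n\<^sub>+\<^sub>1)\<close> and \<open>(-a q\<^sub>n', q\<^sub>n)\<close>.
\<close>

definition lag_rows :: "real \<Rightarrow> real \<Rightarrow> nat \<Rightarrow> 2 mpoly" where
  "lag_rows \<alpha> a n = (let q = lag \<alpha> n in
     mat2 (q - pderiv q) (- C (a * (real (Suc n) + \<alpha>)) * q)
          (- C a * pderiv q) (q + C (a^2) * X * pderiv q))"

text \<open>The matrix G_n of the introduction; \<open>lag_rows_norm\<close> is its inverse, which
  exists because 1 + a^2 n > 0.\<close>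

definition lag_rows_lead :: "real \<Rightarrow> real \<Rightarrow> nat \<Rightarrow> 2 cmat" where
  "lag_rows_lead \<alpha> a n =
     mat2 1 (- of_real (a * (real (Suc n) + \<alpha>))) 0 (of_real (1 + a^2 * real n))"

definition lag_rows_norm :: "real \<Rightarrow> real \<Rightarrow> nat \<Rightarrow> 2 cmat" where
  "lag_rows_norm \<alpha> a n =
     mat2 1 (of_real (a * (real (Suc n) + \<alpha>) / (1 + a^2 * real n))) 0
       (of_real (1 / (1 + a^2 * real n)))"

lemma one_plus_square_pos: "1 + a^2 * real n > 0"
  by (intro add_pos_nonneg) simp_all

lemma lag_rows_norm: "lag_rows_norm \<alpha> a n ** lag_rows_lead \<alpha> a n = mat 1"
  "lag_rows_lead \<alpha> a n ** lag_rows_norm \<alpha> a n = mat 1"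
proof -
  define b c where "b = a * (real (Suc n) + \<alpha>)" and "c = 1 + a^2 * real n"
  have c: "c \<noteq> 0"
    using one_plus_square_pos[of a n] by (simp add: c_def)
  show "lag_rows_norm \<alpha> a n ** lag_rows_lead \<alpha> a n = mat 1"
    "lag_rows_lead \<alpha> a n ** lag_rows_norm \<alpha> a n = mat 1"
    unfolding lag_rows_norm_def lag_rows_lead_def mat2_eq_iff matrix_mult_nth_2
      b_def[symmetric] c_def[symmetric]
    using c by (simp_all add: mat_def)
qed

lemma mpoly_coeff_lag_rows:
  "mpoly_coeff (lag_rows \<alpha> a n) n = lag_rows_lead \<alpha> a n"
  "k > n \<Longrightarrow> mpoly_coeff (lag_rows \<alpha> a n) k = 0"
proof -
  show "mpoly_coeff (lag_rows \<alpha> a n) n = lag_rows_lead \<alpha> a n"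
    by (cases n) (simp_all add: mat2_eq_iff lag_rows_def lag_rows_lead_def coeff_pderiv coeff_lag Let_def
      coeff_pCons' algebra_simps del: lag.simps)
  show "mpoly_coeff (lag_rows \<alpha> a n) k = 0" if "k > n"
    using that by (simp add: mat2_eq_iff lag_rows_def coeff_pderiv coeff_lag Let_def coeff_pCons')
qed

lemma graded_basis_lag_rows: "graded_basis (lag_rows \<alpha> a)"
  unfolding graded_basis_def invertible_def
  using mpoly_coeff_lag_rows lag_rows_norm by metis

text \<open>The inner product after the factorisation of W by T. It is bilinear, without
  conjugation, and is compared with \<open>weight_inner\<close> only for Q with real
  coefficients.\<close>

definition lag_inner :: "real \<Rightarrow> real \<Rightarrow> 2 mpoly \<Rightarrow> 2 mpoly \<Rightarrow> 2 cmat" where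
  "lag_inner \<alpha> a P Q = (\<chi> i j. wint \<alpha> (X * (P $ i $ 1 * Q $ j $ 1) +
     (C a * X * P $ i $ 1 + P $ i $ 2) * (C a * X * Q $ j $ 1 + Q $ j $ 2)))"

definition real_mpoly :: "'n::finite mpoly \<Rightarrow> bool" where
  "real_mpoly P \<longleftrightarrow> (\<forall>i j k. coeff (P $ i $ j) k \<in> \<real>)"

lemma cnj_real_mpoly:
  assumes "real_mpoly Q"
  shows "cnj (poly (Q $ i $ j) (of_real x)) = poly (Q $ i $ j) (of_real x)"
  unfolding Reals_cnj_iff[symmetric] poly_altdef
  using assms by (intro sum_in_Reals Reals_mult Reals_power Reals_of_real) (simp add: real_mpoly_def)

lemma weight_inner_W_lag:
  assumes \<alpha>: "\<alpha> > -1" and Q: "real_mpoly Q"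
  shows "weight_inner 0 \<infinity> (W_lag \<alpha> a) P Q = lag_inner \<alpha> a P Q"
proof -
  define F where "F x = mpoly_eval P x ** W_lag \<alpha> a x ** conj_transpose (mpoly_eval Q x)" for x
  define p where "p i j = X * (P $ i $ 1 * Q $ j $ 1) +
     (C a * X * P $ i $ 1 + P $ i $ 2) * (C a * X * Q $ j $ 1 + Q $ j $ 2)" for i j
  have F: "F x $ i $ j = complex_of_real (exp (- x) * x powr \<alpha>) * poly (p i j) (of_real x)" for x i j
    unfolding F_def matrix_mult_nth_2 mpoly_eval_def W_lag_def conj_transpose_def p_def
    by (simp add: transpose_def cnj_real_mpoly[OF Q] power2_eq_square algebra_simps)
  \<comment> \<open>Matrix units are bounded linear maps, through which the scalar integrals
    assemble into the matrix-valued one.\<close>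
  define unit :: "2 \<Rightarrow> 2 \<Rightarrow> complex \<Rightarrow> 2 cmat" where "unit i j z = axis i (axis j z)" for i j z
  have unit: "bounded_linear (unit i j)" for i j
    unfolding linear_conv_bounded_linear[symmetric]
    by (rule linearI) (simp_all add: unit_def vec_eq_iff axis_def)
  have expand: "A = (\<Sum>i\<in>UNIV. \<Sum>j\<in>UNIV. unit i j (A $ i $ j))" for A
    by (simp add: mat2_eq_iff sum_2 unit_def axis_def)
  have "has_bochner_integral lborel
      (\<lambda>x. \<Sum>i\<in>UNIV. \<Sum>j\<in>UNIV. unit i j (indicator {0<..} x *\<^sub>R F x $ i $ j))
      (\<Sum>i\<in>UNIV. \<Sum>j\<in>UNIV. unit i j (lag_inner \<alpha> a P Q $ i $ j))"
    unfolding F lag_inner_def p_def[symmetric]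
    using has_bochner_integral_wint[OF \<alpha>]
    by (intro has_bochner_integral_sum has_bochner_integral_bounded_linear[OF unit]) simp
  then have "has_bochner_integral lborel (\<lambda>x. indicator {0<..} x *\<^sub>R F x) (lag_inner \<alpha> a P Q)"
    using expand[of "indicator {0<..} x *\<^sub>R F x" for x] expand[of "lag_inner \<alpha> a P Q"]
    by simp
  then show ?thesis
    unfolding weight_inner_def F_def[symmetric]
    by (simp add: interval_lebesgue_integral_0_infty set_lebesgue_integral_def has_bochner_integral_iff)
qed

lemma lag_inner_add:
  assumes "\<alpha> > -1"
  shows "lag_inner \<alpha> a (P + Q) S = lag_inner \<alpha> a P S + lag_inner \<alpha> a Q S"
  unfolding vec_eq_iff lag_inner_def vec_lambda_beta vector_add_component wint_add[OF assms, symmetric]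
  by (intro allI arg_cong[of _ _ "wint \<alpha>"]) (simp only: algebra_simps)

lemma lag_inner_diff:
  assumes "\<alpha> > -1"
  shows "lag_inner \<alpha> a (P - Q) S = lag_inner \<alpha> a P S - lag_inner \<alpha> a Q S"
  using lag_inner_add[OF assms, of a "P - Q" Q S] by simp

lemma lag_inner_0: "lag_inner \<alpha> a 0 S = 0"
  by (simp add: lag_inner_def vec_eq_iff wint_def)

lemma lag_inner_sum: "\<alpha> > -1 \<Longrightarrow> lag_inner \<alpha> a (\<Sum>x\<in>S. f x) Q = (\<Sum>x\<in>S. lag_inner \<alpha> a (f x) Q)"
  by (induction S rule: infinite_finite_induct) (simp_all add: lag_inner_0 lag_inner_add)

lemma lag_inner_commute: "lag_inner \<alpha> a P Q = transpose (lag_inner \<alpha> a Q P)"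
  by (simp add: lag_inner_def vec_eq_iff transpose_def mult.commute mult.left_commute)

lemma lag_inner_const_left:
  assumes "\<alpha> > -1"
  shows "lag_inner \<alpha> a (mpoly_const A ** P) Q = A ** lag_inner \<alpha> a P Q"
proof -
  have const: "c * wint \<alpha> p = wint \<alpha> ([:c:] * p)" for c p
    by (simp add: wint_smult[OF assms])
  show ?thesis
    unfolding vec_eq_iff matrix_mult_nth_2 lag_inner_def vec_lambda_beta mpoly_const_nth
      const wint_add[OF assms, symmetric]
    by (intro allI arg_cong[of _ _ "wint \<alpha>"]) (simp only: algebra_simps)
qed

lemma lag_inner_const_right:
  assumes "\<alpha> > -1"
  shows "lag_inner \<alpha> a P (mpoly_const A ** Q) = lag_inner \<alpha> a P Q ** transpose A"
  by (metis lag_inner_commute lag_inner_const_left[OF assms] matrix_transpose_mul transpose_transpose)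

text \<open>Up to the factor n + 1, q_n - q_n' is the derivative of q_{n+1}, so this is
  \<open>wint_lag_deriv\<close> at n + 1.\<close>

lemma wint_lag_diff_deriv:
  assumes "\<alpha> > -1"
  shows "wint \<alpha> (X * (lag \<alpha> n - pderiv (lag \<alpha> n)) * pderiv v) = wint \<alpha> (lag \<alpha> (Suc n) * v)"
proof -
  have "of_nat (Suc n) * wint \<alpha> (X * (lag \<alpha> n - pderiv (lag \<alpha> n)) * pderiv v) =
      wint \<alpha> (X * pderiv (lag \<alpha> (Suc n)) * pderiv v)"
    unfolding pderiv_lag_Suc wint_of_nat_mult[OF assms, symmetric]
    by (simp only: mult_ac)
  also have "\<dots> = of_nat (Suc n) * wint \<alpha> (lag \<alpha> (Suc n) * v)"
    by (rule wint_lag_deriv[OF assms])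
  finally show ?thesis
    by (simp del: of_nat_Suc lag.simps)
qed

lemma lag_rows_weighted:
  "C a * X * lag_rows \<alpha> a n $ 1 $ 1 + lag_rows \<alpha> a n $ 1 $ 2 = C a * lag \<alpha> (Suc n)"
  "C a * X * lag_rows \<alpha> a n $ 2 $ 1 + lag_rows \<alpha> a n $ 2 $ 2 = lag \<alpha> n"
  by (simp_all add: lag_rows_def Let_def algebra_simps power2_eq_square smult_diff_right
      flip: smult_add_left)

text \<open>After multiplication by T the rows are (q_n - q_n', a q_{n+1}) and (-a q_n', q_n). The
  two terms of each mixed product cancel by \<open>wint_lag_diff_deriv\<close>, for all n and m; the
  diagonal reduces to scalar Laguerre integrals.\<close>

lemma lag_inner_lag_rows:
  assumes \<alpha>: "\<alpha> > -1"
  shows "lag_inner \<alpha> a (lag_rows \<alpha> a n) (lag_rows \<alpha> a m) =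
    mat2 (of_real (1 / real (Suc m) + a^2) * wint \<alpha> (lag \<alpha> (Suc n) * lag \<alpha> (Suc m))) 0
         0 (of_real (1 + a^2 * real n) * wint \<alpha> (lag \<alpha> n * lag \<alpha> m))"
proof -
  define x c where "x = X" and "c = C a"
  have c: "wint \<alpha> (c * p) = of_real a * wint \<alpha> p" for p
    by (simp add: c_def wint_smult[OF \<alpha>])
  let ?q = "lag \<alpha>" and ?u = "\<lambda>n. lag \<alpha> n - pderiv (lag \<alpha> n)"
  note lin = wint_add[OF \<alpha>] wint_diff[OF \<alpha>] c
  have rows: "lag_rows \<alpha> a n $ 1 $ 1 = ?u n" "lag_rows \<alpha> a n $ 2 $ 1 = - (c * pderiv (?q n))" for n
    by (simp_all add: lag_rows_def Let_def c_def)
  have S: "wint \<alpha> (x * (?u n * pderiv v)) = wint \<alpha> (?q (Suc n) * v)" for n v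
    using wint_lag_diff_deriv[OF \<alpha>, of n v] by (simp only: x_def mult.assoc)
  have T: "wint \<alpha> (x * (pderiv (?q n) * pderiv v)) = of_nat n * wint \<alpha> (?q n * v)" for n v
    using wint_lag_deriv[OF \<alpha>, of n v] by (simp only: x_def mult.assoc)
  have cross: "lag_inner \<alpha> a (lag_rows \<alpha> a n) (lag_rows \<alpha> a m) $ 1 $ 2 = 0" for n m
  proof -
    have "lag_inner \<alpha> a (lag_rows \<alpha> a n) (lag_rows \<alpha> a m) $ 1 $ 2 =
       wint \<alpha> (c * (?q (Suc n) * ?q m) - c * (x * (?u n * pderiv (?q m))))"
      unfolding lag_inner_def vec_lambda_beta lag_rows_weighted unfolding rows x_def[symmetric] c_def[symmetric]
      by (rule arg_cong[of _ _ "wint \<alpha>"])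
         (simp only: algebra_simps mult_minus_left mult_minus_right right_minus)
    then show ?thesis
      by (simp only: lin S) simp
  qed
  have "lag_inner \<alpha> a (lag_rows \<alpha> a n) (lag_rows \<alpha> a m) $ 2 $ 1 = 0"
    unfolding lag_inner_commute[of _ _ "lag_rows \<alpha> a n"] transpose_def by (simp add: cross)
  moreover have "lag_inner \<alpha> a (lag_rows \<alpha> a n) (lag_rows \<alpha> a m) $ 2 $ 2 =
      of_real (1 + a^2 * real n) * wint \<alpha> (?q n * ?q m)"
  proof -
    have "lag_inner \<alpha> a (lag_rows \<alpha> a n) (lag_rows \<alpha> a m) $ 2 $ 2 =
       wint \<alpha> (c * (c * (x * (pderiv (?q n) * pderiv (?q m)))) + ?q n * ?q m)"
      unfolding lag_inner_def vec_lambda_beta lag_rows_weighted unfolding rows x_def[symmetric]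
      by (rule arg_cong[of _ _ "wint \<alpha>"]) (simp only: algebra_simps mult_minus_left mult_minus_right minus_minus)
    then show ?thesis
      by (simp only: lin T) (simp add: algebra_simps power2_eq_square)
  qed
  moreover have "lag_inner \<alpha> a (lag_rows \<alpha> a n) (lag_rows \<alpha> a m) $ 1 $ 1 =
      of_real (1 / real (Suc m) + a^2) * wint \<alpha> (?q (Suc n) * ?q (Suc m))"
  proof -
    have "lag_inner \<alpha> a (lag_rows \<alpha> a n) (lag_rows \<alpha> a m) $ 1 $ 1 =
       wint \<alpha> (x * (?u n * ?u m)) + wint \<alpha> (c * (c * (?q (Suc n) * ?q (Suc m))))"
      unfolding lag_inner_def vec_lambda_beta lag_rows_weighted unfolding rows x_def[symmetric] c_def[symmetric]
        wint_add[OF \<alpha>, symmetric]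
      by (rule arg_cong[of _ _ "wint \<alpha>"]) (simp only: algebra_simps)
    moreover have "of_nat (Suc m) * wint \<alpha> (x * (?u n * ?u m)) = wint \<alpha> (?q (Suc n) * ?q (Suc m))"
      unfolding S[symmetric] wint_of_nat_mult[OF \<alpha>, symmetric] pderiv_lag_Suc
      by (simp only: mult_ac)
    then have "wint \<alpha> (x * (?u n * ?u m)) = wint \<alpha> (?q (Suc n) * ?q (Suc m)) / of_nat (Suc m)"
      by (simp del: of_nat_Suc lag.simps add: field_simps)
    ultimately show ?thesis
      by (simp only: c) (simp del: of_nat_Suc lag.simps add: algebra_simps power2_eq_square)
  qed
  ultimately show ?thesis
    by (simp add: mat2_eq_iff cross del: of_nat_Suc lag.simps)
qed

lemma lag_inner_lag_rows_eq_0: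
  "\<alpha> > -1 \<Longrightarrow> n \<noteq> m \<Longrightarrow> lag_inner \<alpha> a (lag_rows \<alpha> a n) (lag_rows \<alpha> a m) = 0"
  unfolding lag_inner_lag_rows mat2_eq_iff by (simp add: wint_lag_orthogonal del: lag.simps)

lemma lag_inner_lag_rows_cancel:
  fixes A :: "2 cmat"
  assumes "\<alpha> > -1" and "A ** lag_inner \<alpha> a (lag_rows \<alpha> a n) (lag_rows \<alpha> a n) = 0"
  shows "A = 0"
proof -
  define h1 h2 where "h1 = of_real (1 / real (Suc n) + a^2) * wint \<alpha> (lag \<alpha> (Suc n) * lag \<alpha> (Suc n))"
    and "h2 = of_real (1 + a^2 * real n) * wint \<alpha> (lag \<alpha> n * lag \<alpha> n)"
  have "1 / real (Suc n) + a^2 > 0"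
    by (intro add_pos_nonneg) simp_all
  moreover have "wint \<alpha> (lag \<alpha> n * lag \<alpha> n) \<noteq> 0" for n
    using wint_lag_square_pos[OF assms(1), of n] by auto
  ultimately have "h1 \<noteq> 0" "h2 \<noteq> 0"
    using one_plus_square_pos[of a n] unfolding h1_def h2_def
    by (metis less_irrefl mult_eq_0_iff of_real_eq_0_iff)+
  moreover have "A ** mat2 h1 0 0 h2 = 0"
    using assms unfolding lag_inner_lag_rows[OF assms(1)] h1_def h2_def by simp
  ultimately show ?thesis
    by (simp add: mat2_eq_iff matrix_mult_nth_2)
qed

section \<open>Monic normalisation and uniqueness\<close>

definition lag_monic :: "real \<Rightarrow> real \<Rightarrow> nat \<Rightarrow> 2 mpoly" where
  "lag_monic \<alpha> a n = mpoly_const (lag_rows_norm \<alpha> a n) ** lag_rows \<alpha> a n"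

lemma real_lag: "coeff (lag \<alpha> n) k \<in> \<real>"
proof (induction n arbitrary: k)
  case 0
  show ?case by simp
next
  case (Suc n)
  show ?case
    by (auto simp: coeff_pCons' coeff_pderiv intro!: Suc Reals_diff Reals_mult Reals_add)
qed

lemma real_lag_monic: "real_mpoly (lag_monic \<alpha> a n)"
proof -
  have "coeff (lag_monic \<alpha> a n $ i $ j) k \<in> \<real>" for k i j
    using exhaust_2[of i] exhaust_2[of j] unfolding lag_monic_def matrix_mult_nth_2
    by (auto simp: lag_rows_norm_def lag_rows_def Let_def coeff_pCons' coeff_pderiv power2_eq_square
        intro!: real_lag Reals_diff Reals_mult Reals_add Reals_divide)
  then show ?thesis
    by (simp add: real_mpoly_def)
qed

lemma monic_of_degree_lag_monic: "monic_of_degree n (lag_monic \<alpha> a n)"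
  by (simp add: monic_of_degree_def lag_monic_def mpoly_coeff_const_mult mpoly_coeff_lag_rows lag_rows_norm)

lemma lag_inner_lag_monic:
  assumes "\<alpha> > -1"
  shows "lag_inner \<alpha> a P (lag_monic \<alpha> a n) = 0 \<longleftrightarrow> lag_inner \<alpha> a P (lag_rows \<alpha> a n) = 0"
proof -
  have "transpose (lag_rows_norm \<alpha> a n) ** transpose (lag_rows_lead \<alpha> a n) = mat 1"
    unfolding matrix_transpose_mul[symmetric] lag_rows_norm transpose_mat ..
  then show ?thesis
    unfolding lag_monic_def lag_inner_const_right[OF assms]
    by (metis matrix_mul_assoc matrix_mul_rid times0_left)
qed

text \<open>Uniqueness is by strong induction: the difference of two candidates has degree below n,
  and pairing it with each earlier R_j kills the coefficient of R_j because its Gram matrix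
  cancels.\<close>

lemma monic_orthogonal_polys_W_lag:
  assumes \<alpha>: "\<alpha> > -1"
  shows "monic_orthogonal_polys 0 \<infinity> (W_lag \<alpha> a) = lag_monic \<alpha> a"
  unfolding monic_orthogonal_polys_def
proof (rule the_equality)
  let ?W = "weight_inner 0 \<infinity> (W_lag \<alpha> a)" and ?M = "lag_monic \<alpha> a"
  have orth: "?W (?M n) (?M m) = 0" if "n \<noteq> m" for n m
    using lag_inner_lag_rows_eq_0[OF \<alpha> that]
    unfolding weight_inner_W_lag[OF \<alpha> real_lag_monic] lag_inner_lag_monic[OF \<alpha>]
    by (simp add: lag_monic_def lag_inner_const_left[OF \<alpha>])
  then show "is_monic_orthogonal 0 \<infinity> (W_lag \<alpha> a) ?M"
    by (simp add: is_monic_orthogonal_def monic_of_degree_lag_monic)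
  fix P
  assume P: "is_monic_orthogonal 0 \<infinity> (W_lag \<alpha> a) P"
  have "P n = ?M n" for n
  proof (induction n rule: less_induct)
    case (less n)
    have "\<forall>k\<ge>n. mpoly_coeff (P n - ?M n) k = 0"
      using P monic_of_degree_lag_monic[of n \<alpha> a]
      by (auto simp: is_monic_orthogonal_def monic_of_degree_def mpoly_coeff_diff le_less)
    then obtain A where A: "P n - ?M n = (\<Sum>k<n. mpoly_const (A k) ** lag_rows \<alpha> a k)"
      using graded_basis_expand[OF graded_basis_lag_rows] by blast
    have "A j = 0" if "j < n" for j
    proof (rule lag_inner_lag_rows_cancel[OF \<alpha>])
      have "?W (P n) (P j) = 0"
        using P that by (simp add: is_monic_orthogonal_def)
      then have "lag_inner \<alpha> a (P n - ?M n) (?M j) = 0"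
        using orth[of n j] less[OF that] that
        by (simp add: weight_inner_W_lag[OF \<alpha> real_lag_monic] lag_inner_diff[OF \<alpha>])
      then have "0 = (\<Sum>k<n. A k ** lag_inner \<alpha> a (lag_rows \<alpha> a k) (lag_rows \<alpha> a j))"
        unfolding lag_inner_lag_monic[OF \<alpha>] A
        by (simp add: lag_inner_sum[OF \<alpha>] lag_inner_const_left[OF \<alpha>])
      also have "\<dots> = (\<Sum>k<n. if k = j then A j ** lag_inner \<alpha> a (lag_rows \<alpha> a j) (lag_rows \<alpha> a j) else 0)"
        by (intro sum.cong) (auto simp: lag_inner_lag_rows_eq_0[OF \<alpha>])
      finally show "A j ** lag_inner \<alpha> a (lag_rows \<alpha> a j) (lag_rows \<alpha> a j) = 0"
        using that by simp
    qed
    then show ?case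
      using A by simp
  qed
  then show "P = ?M" ..
qed

text \<open>Since R_n = G_n P_n with G_n constant and invertible, passing from P_n to R_n only
  conjugates the eigenvalue matrix by G_n.\<close>

lemma weight_diff_algebra_W_lag:
  assumes "\<alpha> > -1"
  shows "weight_diff_algebra 0 \<infinity> (W_lag \<alpha> a) =
    {D \<in> matrix_diff_ops. \<forall>n. \<exists>\<Lambda>. D (lag_rows \<alpha> a n) = mpoly_const \<Lambda> ** lag_rows \<alpha> a n}"
proof -
  have "(\<exists>\<Lambda>. D (lag_monic \<alpha> a n) = mpoly_const \<Lambda> ** lag_monic \<alpha> a n) \<longleftrightarrow>
      (\<exists>\<Lambda>. D (lag_rows \<alpha> a n) = mpoly_const \<Lambda> ** lag_rows \<alpha> a n)" (is "?L \<longleftrightarrow> ?R")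
    if "D \<in> matrix_diff_ops" for D n
  proof
    note D = left_linear_const[OF left_linear_diff_op[OF that]]
    let ?N = "lag_rows_norm \<alpha> a n" and ?G = "lag_rows_lead \<alpha> a n"
    have rows: "lag_rows \<alpha> a n = mpoly_const ?G ** lag_monic \<alpha> a n"
      by (simp add: lag_monic_def matrix_mul_assoc lag_rows_norm flip: mpoly_const_mult)
    show ?R if ?L
    proof -
      obtain \<Lambda> where "D (lag_monic \<alpha> a n) = mpoly_const \<Lambda> ** lag_monic \<alpha> a n"
        using \<open>?L\<close> by blast
      moreover have "D (lag_rows \<alpha> a n) = mpoly_const ?G ** D (lag_monic \<alpha> a n)"
        by (subst rows) (rule D)
      ultimately have "D (lag_rows \<alpha> a n) = mpoly_const (?G ** \<Lambda> ** ?N) ** lag_rows \<alpha> a n"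
        by (simp add: lag_monic_def mpoly_const_mult matrix_mul_assoc)
      then show ?R by blast
    qed
    show ?L if ?R
    proof -
      obtain \<Lambda> where "D (lag_rows \<alpha> a n) = mpoly_const \<Lambda> ** lag_rows \<alpha> a n"
        using \<open>?R\<close> by blast
      then have "D (lag_monic \<alpha> a n) = mpoly_const (?N ** \<Lambda> ** ?G) ** lag_monic \<alpha> a n"
        unfolding mpoly_const_mult matrix_mul_assoc[symmetric] rows[symmetric]
        by (simp add: D lag_monic_def)
      then show ?L by blast
    qed
  qed
  then show ?thesis
    unfolding weight_diff_algebra_def monic_orthogonal_polys_W_lag[OF assms] by blast
qed

section \<open>Eigenvalues of the generators\<close>

text \<open>The ODE and its first two derivatives at a point. They reach order four because
  \<open>D3\<close> has order three and the rows already contain q_n'.\<close>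

lemma poly_pderiv_lag:
  defines "Q \<equiv> (\<lambda>\<alpha> n k z. poly ((pderiv ^^ k) (lag \<alpha> n)) z)"
  shows "z * Q \<alpha> n 2 z = (z - of_real \<alpha> - 1) * Q \<alpha> n 1 z - of_nat n * Q \<alpha> n 0 z"
    and "z * Q \<alpha> n 3 z = (z - of_real \<alpha> - 2) * Q \<alpha> n 2 z - (of_nat n - 1) * Q \<alpha> n 1 z"
    and "z * Q \<alpha> n 4 z = (z - of_real \<alpha> - 3) * Q \<alpha> n 3 z - (of_nat n - 2) * Q \<alpha> n 2 z"
proof -
  define x c N where "x = X" and "c = C (\<alpha> + 1)" and "N = (of_nat n :: complex poly)"
  have d: "pderiv x = 1" "pderiv c = 0" "pderiv N = 0"
    by (simp_all add: x_def c_def N_def pderiv_pCons pderiv_of_nat)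
  have v: "poly x z = z" "poly c z = of_real \<alpha> + 1" "poly N z = of_nat n"
    by (simp_all add: x_def c_def N_def)
  let ?q = "\<lambda>k. (pderiv ^^ k) (lag \<alpha> n)"
  have 0: "x * ?q 2 = (x - c) * ?q 1 - N * ?q 0"
    unfolding x_def c_def N_def using lag_ode[of \<alpha> n] by (simp only: numeral_2_eq_2 funpow.simps o_apply id_apply One_nat_def)
  have q: "pderiv (?q 0) = ?q 1" "pderiv (?q 1) = ?q 2" "pderiv (?q 2) = ?q 3" "pderiv (?q 3) = ?q 4"
    by (simp_all add: eval_nat_numeral)
  have 1: "x * ?q 3 = (x - c - 1) * ?q 2 - (N - 1) * ?q 1"
    using arg_cong[OF 0, of pderiv] unfolding pderiv_mult pderiv_diff d q
    by (simp add: algebra_simps del: funpow.simps One_nat_def)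
  have 2: "x * ?q 4 = (x - c - 2) * ?q 3 - (N - 2) * ?q 2"
    using arg_cong[OF 1, of pderiv] unfolding pderiv_mult pderiv_diff d q pderiv_1
    by (simp add: algebra_simps del: funpow.simps One_nat_def)
  show "z * Q \<alpha> n 2 z = (z - of_real \<alpha> - 1) * Q \<alpha> n 1 z - of_nat n * Q \<alpha> n 0 z"
    "z * Q \<alpha> n 3 z = (z - of_real \<alpha> - 2) * Q \<alpha> n 2 z - (of_nat n - 1) * Q \<alpha> n 1 z"
    "z * Q \<alpha> n 4 z = (z - of_real \<alpha> - 3) * Q \<alpha> n 3 z - (of_nat n - 2) * Q \<alpha> n 2 z"
    using arg_cong[OF 0, of "\<lambda>p. poly p z"] arg_cong[OF 1, of "\<lambda>p. poly p z"]
      arg_cong[OF 2, of "\<lambda>p. poly p z"]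
    unfolding Q_def by (simp_all add: v algebra_simps del: funpow.simps One_nat_def)
qed

text \<open>The t of the introduction, and \<open>eig_s\<close> is the s. Multiplied by a^2 they
  become 1 + a^2 (n + 1) and 1 + a^2 n.\<close>

definition eig_t :: "real \<Rightarrow> nat \<Rightarrow> complex" where
  "eig_t a n = of_real (real (Suc n) + 1 / a^2)"

definition eig_s :: "real \<Rightarrow> nat \<Rightarrow> complex" where
  "eig_s a n = of_real (real n + 1 / a^2)"

text \<open>At each point z every matrix entry is a polynomial identity in z and the values of q_n
  and its derivatives, which follows from the differential relations and the relation for
  1/a.\<close>

lemma
  assumes a: "a \<noteq> 0"
  shows D1_lag_rows: "D1 \<alpha> a (lag_rows \<alpha> a n) =
      mpoly_const (mat2 (- eig_t a n) 0 0 (- eig_s a n)) ** lag_rows \<alpha> a n"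
    and D2_lag_rows: "D2 \<alpha> a (lag_rows \<alpha> a n) =
      mpoly_const (mat2 (eig_t a n) 0 0 0) ** lag_rows \<alpha> a n"
    and D3_lag_rows: "D3 \<alpha> a (lag_rows \<alpha> a n) =
      mpoly_const (mat2 0 (- eig_t a n * of_real (real (Suc n) + \<alpha>)) (- eig_s a n) 0) ** lag_rows \<alpha> a n"
proof -
  define q where "q k = (pderiv ^^ k) (lag \<alpha> n)" for k
  have q: "lag \<alpha> n = q 0" "pderiv (q k) = q (Suc k)" for k
    by (simp_all add: q_def)
  \<comment> \<open>Division by a becomes multiplication by b with the relation A b = 1, so that
    \<open>algebra\<close> works over a ring.\<close>
  define A b al N where "A = complex_of_real a" and "b = inverse A" and "al = complex_of_real \<alpha>"
    and "N = complex_of_nat n"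
  have Ab: "A * b = 1"
    using a by (simp add: A_def b_def)
  have div: "u / A = u * b" "u / A^2 = u * b^2" for u
    by (simp_all add: b_def field_simps)
  have poly_ext: "P = Q" if "\<And>z. poly P z = poly Q z" for P Q :: "complex poly"
    using that by (metis poly_eq_poly_eq_iff ext)
  have ode: "z * poly (q (Suc (Suc 0))) z = (z - al - 1) * poly (q (Suc 0)) z - N * poly (q 0) z"
    "z * poly (q (Suc (Suc (Suc 0)))) z = (z - al - 2) * poly (q (Suc (Suc 0))) z - (N - 1) * poly (q (Suc 0)) z"
    "z * poly (q (Suc (Suc (Suc (Suc 0))))) z =
      (z - al - 3) * poly (q (Suc (Suc (Suc 0)))) z - (N - 2) * poly (q (Suc (Suc 0))) z" for z
    using poly_pderiv_lag[of z \<alpha> n] unfolding q_def al_def N_def by (simp_all only: eval_nat_numeral BitM.simps One_nat_def)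
  note rows = mat2_eq_iff matrix_mult_nth_2 lag_rows_def Let_def diff_op_nth eig_s_def eig_t_def q
  note [simp] = pderiv_diff pderiv_add pderiv_minus pderiv_mult pderiv_pCons pderiv_smult sum_2 q div
    A_def[symmetric] al_def[symmetric] N_def[symmetric]
  show "D1 \<alpha> a (lag_rows \<alpha> a n) =
      mpoly_const (mat2 (- eig_t a n) 0 0 (- eig_s a n)) ** lag_rows \<alpha> a n"
    unfolding D1_def rows
    apply (intro conjI poly_ext)
    subgoal for z
      using ode[of z] Ab by simp algebra
    subgoal for z
      using ode[of z] Ab by simp algebra
    subgoal for z
      using ode[of z] Ab by simp algebra
    subgoal for z
      using ode[of z] Ab by simp algebra
    done
  show "D2 \<alpha> a (lag_rows \<alpha> a n) =
      mpoly_const (mat2 (eig_t a n) 0 0 0) ** lag_rows \<alpha> a n"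
    unfolding D2_def rows
    apply (intro conjI poly_ext)
    subgoal for z
      using ode[of z] Ab by simp algebra
    subgoal for z
      using ode[of z] Ab by simp algebra
    subgoal for z
      using ode[of z] Ab by simp algebra
    subgoal for z
      using ode[of z] Ab by simp algebra
    done
  show "D3 \<alpha> a (lag_rows \<alpha> a n) =
      mpoly_const (mat2 0 (- eig_t a n * of_real (real (Suc n) + \<alpha>)) (- eig_s a n) 0) ** lag_rows \<alpha> a n"
    unfolding D3_def rows
    apply (intro conjI poly_ext)
    subgoal for z
      using ode[of z] Ab by simp algebra
    subgoal for z
      using ode[of z] Ab by simp algebra
    subgoal for z
      using ode[of z] Ab by simp algebra
    subgoal for z
      using ode[of z] Ab by simp algebra
    done
qed

section \<open>Eigenvalues of an arbitrary operator\<close>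

lemma poly_eq_of_nat:
  fixes p q :: "complex poly"
  assumes "\<And>n. poly p (of_nat n) = poly q (of_nat n)"
  shows "p = q"
proof (rule ccontr)
  assume "p \<noteq> q"
  then have "finite {x. poly (p - q) x = 0}"
    by (intro poly_roots_finite) simp
  moreover have "range (of_nat :: nat \<Rightarrow> complex) \<subseteq> {x. poly (p - q) x = 0}"
    using assms by auto
  moreover have "infinite (range (of_nat :: nat \<Rightarrow> complex))"
    by (rule range_inj_infinite) (rule inj_of_nat)
  ultimately show False
    using finite_subset by blast
qed

lemma degree_lag: "degree (lag \<alpha> n) \<le> n"
  by (rule degree_le) (simp add: coeff_lag)

text \<open>Since q_{n+1}' = (n + 1) (q_n - q_n'), the first entries cancel. This isolates a single
  Laguerre polynomial on which an operator can be tested.\<close>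

lemma lag_rows_combination:
  "mpoly_const (mat2 (of_real (a * real (Suc n))) 0 0 0) ** lag_rows \<alpha> a n +
     mpoly_const (mat2 0 1 0 0) ** lag_rows \<alpha> a (Suc n) =
   mat2 0 (smult (of_real (1 + a^2 * real (Suc n))) (lag \<alpha> (Suc n))) 0 0"
proof -
  define x where "x = X"
  let ?q = "lag \<alpha> n" and ?r = "lag \<alpha> (Suc n)"
  define b N where "b = complex_of_real (real (Suc n) + \<alpha>)" and "N = complex_of_nat (Suc n)"
  have r: "?r = x * (?q - pderiv ?q) - smult b ?q"
    by (simp add: x_def b_def)
  have r': "pderiv ?r = smult N (?q - pderiv ?q)"
    unfolding pderiv_lag_Suc N_def by (simp add: of_nat_poly)
  have "x * pderiv ?r = smult N (?r + smult b ?q)"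
    unfolding r' using r by simp
  moreover have "complex_of_real (1 + a^2 * real (Suc n)) = 1 + (of_real a)^2 * N"
    by (simp add: N_def)
  ultimately show ?thesis
    unfolding mat2_eq_iff vector_add_component matrix_mult_nth_2
    by (simp add: lag_rows_def Let_def r' smult_add_left smult_add_right power2_eq_square mult_ac
        flip: x_def b_def N_def del: lag.simps of_nat_Suc of_real_add)
qed

text \<open>
  In the coordinates given by \<open>T\<close>, the lower right entry \<open>A\<close> of such an operator maps
  \<open>(1 + a\<^sup>2n) q\<^sub>n\<close> to a combination of \<open>q\<^sub>n\<^sub>-\<^sub>1\<close> and \<open>d q\<^sub>n\<close>. Its leading eigenvalue is polynomial in \<open>n\<close>,
  whence \<open>d = 0\<close>; since the Taylor coefficients of \<open>q\<^sub>n / q\<^sub>n(0)\<close> at \<open>0\<close> are polynomial in \<open>n\<close> as well,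
  evaluation at \<open>0\<close> forces the zeros of \<open>\<nu>\<close>.
\<close>

lemma second_column_eigenvalues:
  assumes \<alpha>: "\<alpha> > -1" and a: "a \<noteq> 0" and D: "D \<in> matrix_diff_ops"
    and eig: "\<And>n. D (lag_rows \<alpha> a n) = mpoly_const (mat2 0 (\<nu> n) 0 d) ** lag_rows \<alpha> a n"
  shows "d = 0"
    and "\<exists>w. \<forall>n. \<nu> n = eig_t a n * of_real (real (Suc n) + \<alpha>) * poly w (eig_t a n)"
proof -
  obtain Fs where Fs: "D = diff_op Fs"
    using D by (auto simp: matrix_diff_ops_def)
  note lin = left_linear_add[OF left_linear_diff_op[OF D]] left_linear_const[OF left_linear_diff_op[OF D]]
  \<comment> \<open>T fixes the row (0, p); the second component of its image under D followed by T
    is the sum of the p^(k) \<open>f k\<close>.\<close>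
  define f where "f k = C a * X * (Fs ! k) $ 2 $ 1 + (Fs ! k) $ 2 $ 2" for k
  define A where "A p = (\<Sum>k<length Fs. (pderiv ^^ k) p * f k)" for p
  have A_add: "A (p + q) = A p + A q" for p q
    by (simp add: A_def higher_pderiv_add sum.distrib distrib_right)
  have A_smult: "A (smult c p) = smult c (A p)" for p c
    using sum_distrib_left[of "[:c:]" "\<lambda>k. (pderiv ^^ k) p * f k"]
    by (simp add: A_def higher_pderiv_smult)
  have A_eq: "C a * X * D (mat2 0 p 0 0) $ 1 $ 1 + D (mat2 0 p 0 0) $ 1 $ 2 = A p" for p
    unfolding Fs diff_op_nth sum_2 mat2_nth A_def f_def sum_distrib_left sum.distrib[symmetric]
    by (rule sum.cong) (simp_all only: higher_pderiv_0 algebra_simps mult_zero_left mult_zero_right add_0_left)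
  define h where "h n = complex_of_real (1 + a^2 * real n)" for n
  have h: "h n \<noteq> 0" for n
    using one_plus_square_pos[of a n] unfolding h_def of_real_eq_0_iff by simp
  \<comment> \<open>D turns both rows of \<open>lag_rows_combination\<close> into multiples of
    second rows, whose second component after T is a Laguerre polynomial.\<close>
  have A_Suc: "A (smult (h (Suc n)) (lag \<alpha> (Suc n))) =
      smult (of_real (a * real (Suc n)) * \<nu> n) (lag \<alpha> n) + smult d (lag \<alpha> (Suc n))" for n
  proof -
    let ?u = "of_real (a * real (Suc n)) :: complex"
    let ?P = "mat2 0 (smult (h (Suc n)) (lag \<alpha> (Suc n))) 0 0"
    have "D ?P = mpoly_const (mat2 0 (?u * \<nu> n) 0 0) ** lag_rows \<alpha> a n +
        mpoly_const (mat2 0 d 0 0) ** lag_rows \<alpha> a (Suc n)"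
      unfolding h_def lag_rows_combination[symmetric] lin eig matrix_mul_assoc mpoly_const_mult[symmetric]
      by (intro arg_cong2[of _ _ _ _ "(+)"] arg_cong[of _ _ "\<lambda>M. mpoly_const M ** _"])
         (simp_all add: mat2_eq_iff matrix_mult_nth_2)
    note DP = this
    have "D ?P $ 1 $ j = [:?u * \<nu> n:] * lag_rows \<alpha> a n $ 2 $ j +
        [:d:] * lag_rows \<alpha> a (Suc n) $ 2 $ j" for j
      unfolding DP matrix_mult_nth_2 vector_add_component by simp
    then have "A (smult (h (Suc n)) (lag \<alpha> (Suc n))) =
        [:?u * \<nu> n:] * (C a * X * lag_rows \<alpha> a n $ 2 $ 1 + lag_rows \<alpha> a n $ 2 $ 2) +
        [:d:] * (C a * X * lag_rows \<alpha> a (Suc n) $ 2 $ 1 + lag_rows \<alpha> a (Suc n) $ 2 $ 2)"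
      unfolding A_eq[symmetric] by (simp only: algebra_simps)
    then show ?thesis
      unfolding lag_rows_weighted by simp
  qed
  have A_0: "A 1 = [:d:]"
  proof -
    have "mat2 0 1 0 0 = mpoly_const (mat2 0 1 0 0) ** lag_rows \<alpha> a 0"
      by (simp add: mat2_eq_iff matrix_mult_nth_2 lag_rows_def)
    then have "D (mat2 0 1 0 0) = mpoly_const (mat2 0 1 0 0 ** mat2 0 (\<nu> 0) 0 d) ** lag_rows \<alpha> a 0"
      using lin(2) eig by (simp add: mpoly_const_mult matrix_mul_assoc)
    then show ?thesis
      unfolding A_eq[symmetric] by (simp add: matrix_mult_nth_2 lag_rows_def)
  qed
  have "degree (A p) \<le> n" if "degree p \<le> n" for p n
    using that
  proof (induction n arbitrary: p)
    case 0
    then obtain c where "p = smult c 1"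
      using degree_0_id[of p] by (metis le_zero_eq smult_one)
    then show ?case
      by (simp add: A_smult A_0 del: smult_one)
  next
    case (Suc n)
    define c where "c = coeff p (Suc n)"
    define r where "r = p - smult c (lag \<alpha> (Suc n))"
    have "coeff r k = 0" if "k > n" for k
      using that Suc.prems by (cases "k = Suc n") (simp_all add: r_def c_def coeff_lag coeff_eq_0 del: lag.simps)
    then have "degree (A r) \<le> n"
      by (intro Suc.IH degree_le) simp
    moreover have "degree (A (lag \<alpha> (Suc n))) \<le> Suc n"
    proof -
      have "smult (h (Suc n)) (A (lag \<alpha> (Suc n))) =
          smult (of_real (a * real (Suc n)) * \<nu> n) (lag \<alpha> n) + smult d (lag \<alpha> (Suc n))"
        using A_Suc by (simp only: A_smult)
      moreover have "degree \<dots> \<le> Suc n"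
        by (intro degree_add_le order.trans[OF degree_smult_le] degree_lag order.trans[OF degree_lag le_SucI]) simp
      ultimately show ?thesis
        using h[of "Suc n"] by (metis degree_smult_eq)
    qed
    moreover have "A p = A r + smult c (A (lag \<alpha> (Suc n)))"
      unfolding A_smult[symmetric] A_add[symmetric] by (simp add: r_def)
    ultimately show ?case
      by (auto intro!: degree_add_le order.trans[OF degree_smult_le])
  qed
  then have "\<exists>g. \<forall>p n. degree p \<le> n \<longrightarrow> coeff (A p) n = coeff p n * poly g (of_nat n)"
    unfolding A_def by (intro coeff_degree_preserving_op) blast
  then obtain g where g: "degree p \<le> n \<Longrightarrow> coeff (A p) n = coeff p n * poly g (of_nat n)" for p n
    by blast
  have "h n * poly g (of_nat n) = d" for n
  proof (cases n)
    case 0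
    then show ?thesis
      using g[of 1 0] by (simp add: A_0 h_def)
  next
    case (Suc m)
    have "coeff (A (smult (h n) (lag \<alpha> n))) n = h n * poly g (of_nat n)"
      using g[of "smult (h n) (lag \<alpha> n)" n] degree_lag[of \<alpha> n] by (simp add: coeff_lag h)
    then show ?thesis
      unfolding Suc A_Suc by (simp add: coeff_lag del: lag.simps)
  qed
  \<comment> \<open>A nonzero g would make the left side nonconstant because a is nonzero.\<close>
  then have "[:1, of_real (a^2):] * g = [:d:]"
    by (intro poly_eq_of_nat) (simp add: h_def algebra_simps)
  moreover have "degree ([:1, of_real (a^2):] * g) = Suc (degree g)" if "g \<noteq> 0"
    using that a by (subst degree_mult_eq) auto
  ultimately have "g = 0"
    by (metis degree_pCons_0 nat.distinct(1))
  with \<open>[:1, of_real (a^2):] * g = [:d:]\<close> show d: "d = 0"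
    by simp

  obtain T where T: "coeff (lag \<alpha> n) k = coeff (lag \<alpha> n) 0 * poly (T k) (of_nat n)" for n k
    using coeff_lag_taylor[OF \<alpha>] by metis
  \<comment> \<open>The k-th derivative of q_n at 0 is k! (here \<open>pochhammer 1 k\<close>) times
    its Taylor coefficient.\<close>
  define z where "z = (\<Sum>k<length Fs. smult (pochhammer 1 k * coeff (f k) 0) (T k))"
  have z: "coeff (A (lag \<alpha> n)) 0 = coeff (lag \<alpha> n) 0 * poly z (of_nat n)" for n
  proof -
    have "coeff (A (lag \<alpha> n)) 0 = (\<Sum>k<length Fs. pochhammer 1 k * coeff (lag \<alpha> n) k * coeff (f k) 0)"
      by (simp add: A_def coeff_sum coeff_mult_0 coeff_higher_pderiv)
    also have "\<dots> = (\<Sum>k<length Fs. coeff (lag \<alpha> n) 0 * (pochhammer 1 k * coeff (f k) 0 * poly (T k) (of_nat n)))"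
      by (rule sum.cong[OF refl], subst T) (simp only: mult_ac)
    finally show ?thesis
      by (simp add: z_def poly_sum sum_distrib_left)
  qed
  \<comment> \<open>From A 1 = d = 0 follows z(0) = 0. The factor n split off here, taken at n + 1,
    cancels the n + 1 in \<open>A_Suc\<close>.\<close>
  obtain w where w: "z = pCons 0 w"
    using z[of 0] A_0 d by (cases z) simp
  have \<nu>: "of_real a * \<nu> n = - h (Suc n) * of_real (real (Suc n) + \<alpha>) * poly w (of_nat (Suc n))" for n
  proof -
    have "h (Suc n) * (coeff (lag \<alpha> (Suc n)) 0 * poly z (of_nat (Suc n))) =
        of_real (a * real (Suc n)) * \<nu> n * coeff (lag \<alpha> n) 0"
      using arg_cong[OF A_Suc, of "\<lambda>p. coeff p 0" n] unfolding A_smult coeff_smult z d by simp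
    then have "coeff (lag \<alpha> n) 0 * of_nat (Suc n) * (of_real a * \<nu> n) = coeff (lag \<alpha> n) 0 * of_nat (Suc n) *
        (- h (Suc n) * of_real (real (Suc n) + \<alpha>) * poly w (of_nat (Suc n)))"
      unfolding w coeff_lag_0 by (simp del: of_nat_Suc of_real_add add: algebra_simps)
    moreover have "coeff (lag \<alpha> n) 0 * of_nat (Suc n) \<noteq> 0"
      using coeff_lag_0_nonzero[OF \<alpha>, of n] by (simp del: of_nat_Suc)
    ultimately show ?thesis
      by (rule mult_left_cancel[THEN iffD1, rotated])
  qed
  \<comment> \<open>The polynomial w is evaluated at n + 1 = t - 1/a^2.\<close>
  have "\<nu> n = eig_t a n * of_real (real (Suc n) + \<alpha>) *
      poly (smult (- of_real a) (pcompose w [:- of_real (1 / a^2), 1:])) (eig_t a n)" for n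
  proof -
    have "poly (pcompose w [:- of_real (1 / a^2), 1:]) (eig_t a n) = poly w (of_nat (Suc n))"
      by (simp add: poly_pcompose eig_t_def)
    moreover have "h (Suc n) = of_real (a^2) * eig_t a n"
      using a by (simp add: h_def eig_t_def field_simps flip: of_real_mult of_real_add)
    ultimately have "of_real a * \<nu> n = of_real a * (eig_t a n * of_real (real (Suc n) + \<alpha>) *
      poly (smult (- of_real a) (pcompose w [:- of_real (1 / a^2), 1:])) (eig_t a n))"
      unfolding \<nu> by (simp add: power2_eq_square del: of_nat_Suc)
    moreover have "complex_of_real a \<noteq> 0"
      using a by simp
    ultimately show ?thesis
      by (rule mult_left_cancel[THEN iffD1, rotated])
  qed
  then show "\<exists>w. \<forall>n. \<nu> n = eig_t a n * of_real (real (Suc n) + \<alpha>) * poly w (eig_t a n)"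
    by blast
qed

section \<open>The generated algebra\<close>

lemma mat2_add: "mat2 p q r s + mat2 p' q' r' s' = mat2 (p + p') (q + q') (r + r') (s + s')"
  for p :: "'a::monoid_add"
  by (simp add: mat2_eq_iff)

lemma mat2_mult: "mat2 p q r s ** mat2 p' q' r' s' =
    mat2 (p * p' + q * r') (p * q' + q * s') (r * p' + s * r') (r * q' + s * s')"
  for p :: "'a::semiring_1"
  by (simp add: mat2_eq_iff matrix_mult_nth_2)

definition lag_algebra :: "real \<Rightarrow> real \<Rightarrow> 2 mop set" where
  "lag_algebra \<alpha> a = generated_algebra {mop_one, D1 \<alpha> a, D2 \<alpha> a, D3 \<alpha> a}"

definition realizable :: "real \<Rightarrow> real \<Rightarrow> (nat \<Rightarrow> 2 cmat) \<Rightarrow> bool" where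
  "realizable \<alpha> a \<Lambda> \<longleftrightarrow> (\<exists>D\<in>lag_algebra \<alpha> a. \<forall>n. D (lag_rows \<alpha> a n) = mpoly_const (\<Lambda> n) ** lag_rows \<alpha> a n)"

lemma mop_one_apply: "mop_one P = P"
  by (simp add: mop_one_def diff_op_def)

lemma lag_algebra_diff_ops: "D \<in> lag_algebra \<alpha> a \<Longrightarrow> D \<in> matrix_diff_ops"
  unfolding lag_algebra_def
proof (induction rule: generated_algebra.induct)
  case (gen D)
  then show ?case
    by (auto simp: mop_one_def D1_def D2_def D3_def matrix_diff_ops_def)
qed (simp_all add: matrix_diff_ops_0 matrix_diff_ops_scale matrix_diff_ops_mult matrix_diff_ops_add mop_add_def)

lemma realizable_add:
  assumes "realizable \<alpha> a L" "realizable \<alpha> a M"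
  shows "realizable \<alpha> a (\<lambda>n. L n + M n)"
proof -
  obtain D E where "D \<in> lag_algebra \<alpha> a" "E \<in> lag_algebra \<alpha> a"
    and "\<And>n. D (lag_rows \<alpha> a n) = mpoly_const (L n) ** lag_rows \<alpha> a n"
    and "\<And>n. E (lag_rows \<alpha> a n) = mpoly_const (M n) ** lag_rows \<alpha> a n"
    using assms by (auto simp: realizable_def)
  then show ?thesis
    unfolding realizable_def lag_algebra_def
    by (intro bexI[of _ "mop_add D E"] generated_algebra.add)
       (simp_all add: mop_add_def mpoly_const_add matrix_mult_add_left)
qed

text \<open>The order of factors is kept: E passes the constant left factor L_n and then produces
  M_n.\<close>

lemma realizable_mult:
  assumes "realizable \<alpha> a L" "realizable \<alpha> a M"
  shows "realizable \<alpha> a (\<lambda>n. L n ** M n)"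
proof -
  obtain D E where DE: "D \<in> lag_algebra \<alpha> a" "E \<in> lag_algebra \<alpha> a"
    and "\<And>n. D (lag_rows \<alpha> a n) = mpoly_const (L n) ** lag_rows \<alpha> a n"
    and "\<And>n. E (lag_rows \<alpha> a n) = mpoly_const (M n) ** lag_rows \<alpha> a n"
    using assms by (auto simp: realizable_def)
  then show ?thesis
    unfolding realizable_def lag_algebra_def
    by (intro bexI[of _ "mop_mult D E"] generated_algebra.mult)
       (simp_all add: mop_mult_def mpoly_const_mult matrix_mul_assoc
         left_linear_const[OF left_linear_diff_op[OF lag_algebra_diff_ops[OF DE(2)]]])
qed

lemma realizable_const: "realizable \<alpha> a (\<lambda>n. mat2 c 0 0 c)"
proof -
  have "mat c = mat2 c 0 0 c"
    by (simp add: mat2_eq_iff mat_def)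
  then show ?thesis
    unfolding realizable_def lag_algebra_def
    by (intro bexI[of _ "mop_scale c mop_one"] generated_algebra.scale generated_algebra.gen)
       (simp_all add: mop_scale_def mop_one_apply mpoly_scale_eq)
qed

lemma realizable_scale: "realizable \<alpha> a L \<Longrightarrow> realizable \<alpha> a (\<lambda>n. mat2 c 0 0 c ** L n)"
  by (rule realizable_mult[OF realizable_const])

lemma
  assumes a: "a \<noteq> 0"
  shows realizable_11: "realizable \<alpha> a (\<lambda>n. mat2 (eig_t a n) 0 0 0)"
    and realizable_22: "realizable \<alpha> a (\<lambda>n. mat2 0 0 0 (eig_s a n))"
    and realizable_12: "realizable \<alpha> a (\<lambda>n. mat2 0 (eig_t a n * of_real (real (Suc n) + \<alpha>)) 0 0)"
    and realizable_21: "realizable \<alpha> a (\<lambda>n. mat2 0 0 (eig_s a n) 0)"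
proof -
  have gens: "realizable \<alpha> a (\<lambda>n. mat2 (- eig_t a n) 0 0 (- eig_s a n))"
    "realizable \<alpha> a (\<lambda>n. mat2 (eig_t a n) 0 0 0)"
    "realizable \<alpha> a (\<lambda>n. mat2 0 (- eig_t a n * of_real (real (Suc n) + \<alpha>)) (- eig_s a n) 0)"
    unfolding realizable_def lag_algebra_def
    by (rule bexI[OF _ generated_algebra.gen], intro allI, rule D1_lag_rows[OF a] D2_lag_rows[OF a] D3_lag_rows[OF a], simp)+
  then show "realizable \<alpha> a (\<lambda>n. mat2 (eig_t a n) 0 0 0)" by blast
  note [simp] = mat2_add mat2_mult
  note minus = realizable_scale[where c = "-1"] and half = realizable_scale[where c = "1/2"]
  show "realizable \<alpha> a (\<lambda>n. mat2 0 0 0 (eig_s a n))"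
    using minus[OF realizable_add[OF gens(1,2)]] by simp
  \<comment> \<open>Bracketing \<open>D3\<close> with \<open>D1\<close> changes the sign of one off-diagonal entry only.\<close>
  note comm = realizable_add[OF realizable_mult[OF gens(1,3)] minus[OF realizable_mult[OF gens(3,1)]]]
  \<comment> \<open>Because t - s = 1, the bracket multiplies the upper right entry by -1 and the
    lower left entry by 1.\<close>
  have t: "eig_t a n = eig_s a n + 1" for n
    by (simp add: eig_t_def eig_s_def)
  show "realizable \<alpha> a (\<lambda>n. mat2 0 (eig_t a n * of_real (real (Suc n) + \<alpha>)) 0 0)"
    using half[OF realizable_add[OF comm minus[OF gens(3)]]]
    by (simp add: t algebra_simps)
  show "realizable \<alpha> a (\<lambda>n. mat2 0 0 (eig_s a n) 0)"
    using minus[OF half[OF realizable_add[OF comm gens(3)]]]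
    by (simp add: t algebra_simps)
qed

text \<open>Horner recursion: S acts on M as the scalar x, so powers of x times M are realizable
  without the scalar matrix x I being so.\<close>

lemma realizable_poly:
  assumes "realizable \<alpha> a M" and "realizable \<alpha> a S" and "\<And>n. S n ** M n = mat2 (x n) 0 0 (x n) ** M n"
  shows "realizable \<alpha> a (\<lambda>n. mat2 (poly f (x n)) 0 0 (poly f (x n)) ** M n)"
proof (induction f)
  case 0
  show ?case
    using realizable_const[of \<alpha> a 0] realizable_scale[OF assms(1), of 0] by simp
next
  case (pCons c f)
  have "mat2 (poly (pCons c f) (x n)) 0 0 (poly (pCons c f) (x n)) ** M n =
      mat2 c 0 0 c ** M n + S n ** (mat2 (poly f (x n)) 0 0 (poly f (x n)) ** M n)" for n
  proof -
    have "S n ** (mat2 y 0 0 y ** M n) = mat2 y 0 0 y ** (S n ** M n)" for y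
      by (simp add: mat2_eq_iff matrix_mult_nth_2 algebra_simps)
    then show ?thesis
      unfolding assms(3) by (simp add: mat2_eq_iff matrix_mult_nth_2 algebra_simps)
  qed
  then show ?case
    using realizable_add[OF realizable_scale[OF assms(1), of c] realizable_mult[OF assms(2) pCons.IH]]
    by simp
qed

text \<open>Each entry is a polynomial multiple of a realizable matrix unit. The identity supplies
  the common constant c, which is the condition \<lambda>(0) = \<mu>(0).\<close>

lemma realizable_general:
  assumes a: "a \<noteq> 0"
  shows "realizable \<alpha> a (\<lambda>n. mat2
      (c + eig_t a n * poly f1 (eig_t a n)) (eig_t a n * of_real (real (Suc n) + \<alpha>) * poly f2 (eig_t a n))
      (eig_s a n * poly f3 (eig_s a n)) (c + eig_s a n * poly f4 (eig_s a n)))"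
proof -
  note e11 = realizable_11[OF a, of \<alpha>] and e22 = realizable_22[OF a, of \<alpha>]
  note add = realizable_add
  note p11 = realizable_poly[OF e11 e11, of "eig_t a" f1]
  note p12 = realizable_poly[OF realizable_12[OF a] e11, of "eig_t a" f2]
  note p21 = realizable_poly[OF realizable_21[OF a] e22, of "eig_s a" f3]
  note p22 = realizable_poly[OF e22 e22, of "eig_s a" f4]
  show ?thesis
    using add[OF realizable_const[of \<alpha> a c] add[OF add[OF p11 p12] add[OF p21 p22]]]
    by (simp add: mat2_add mat2_mult mult_ac)
qed

section \<open>The two inclusions\<close>

lemma lag_algebra_eigen:
  assumes "a \<noteq> 0" and "D \<in> lag_algebra \<alpha> a"
  shows "\<exists>\<Lambda>. D (lag_rows \<alpha> a n) = mpoly_const \<Lambda> ** lag_rows \<alpha> a n"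
  using assms(2) unfolding lag_algebra_def
proof (induction rule: generated_algebra.induct)
  case (gen D)
  then show ?case
    using D1_lag_rows[OF assms(1)] D2_lag_rows[OF assms(1)] D3_lag_rows[OF assms(1)]
    by (auto simp: mop_one_apply intro: exI[of _ "mat 1"])
next
  case zero
  show ?case by (rule exI[of _ 0]) simp
next
  case (add D E)
  then obtain \<Lambda> M where "D (lag_rows \<alpha> a n) = mpoly_const \<Lambda> ** lag_rows \<alpha> a n"
    and "E (lag_rows \<alpha> a n) = mpoly_const M ** lag_rows \<alpha> a n"
    by blast
  then have "mop_add D E (lag_rows \<alpha> a n) = mpoly_const (\<Lambda> + M) ** lag_rows \<alpha> a n"
    by (simp add: mop_add_def mpoly_const_add matrix_mult_add_left)
  then show ?case ..
next
  case (scale D c)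
  then obtain \<Lambda> where "D (lag_rows \<alpha> a n) = mpoly_const \<Lambda> ** lag_rows \<alpha> a n"
    by blast
  then have "mop_scale c D (lag_rows \<alpha> a n) = mpoly_const (mat c ** \<Lambda>) ** lag_rows \<alpha> a n"
    by (simp add: mop_scale_def mpoly_scale_eq mpoly_const_mult matrix_mul_assoc)
  then show ?case ..
next
  case (mult D E)
  then obtain \<Lambda> M where "D (lag_rows \<alpha> a n) = mpoly_const \<Lambda> ** lag_rows \<alpha> a n"
    and "E (lag_rows \<alpha> a n) = mpoly_const M ** lag_rows \<alpha> a n"
    by blast
  moreover have "left_linear E"
    using mult.hyps lag_algebra_diff_ops left_linear_diff_op unfolding lag_algebra_def by blast
  ultimately have "mop_mult D E (lag_rows \<alpha> a n) = mpoly_const (\<Lambda> ** M) ** lag_rows \<alpha> a n"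
    by (simp add: mop_mult_def left_linear_const mpoly_const_mult matrix_mul_assoc)
  then show ?case ..
qed

lemma poly_eig_t: "poly (pcompose p [:- of_real (1 + 1 / a^2), 1:]) (eig_t a n) = poly p (of_nat n)"
  by (simp add: poly_pcompose eig_t_def)

lemma poly_eig_s: "poly (pcompose p [:- of_real (1 / a^2), 1:]) (eig_s a n) = poly p (of_nat n)"
  by (simp add: poly_pcompose eig_s_def)

lemma diff_op_in_lag_algebra:
  assumes \<alpha>: "\<alpha> > -1" and a: "a \<noteq> 0" and D: "D \<in> matrix_diff_ops"
    and eig: "\<And>n. \<exists>\<Lambda>. D (lag_rows \<alpha> a n) = mpoly_const \<Lambda> ** lag_rows \<alpha> a n"
  shows "D \<in> lag_algebra \<alpha> a"
proof -
  let ?R = "lag_rows \<alpha> a"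
  obtain L where L: "D (?R n) = mpoly_const (L n) ** ?R n" for n
    using eig by metis
  note lin = left_linear_diff_op[OF D]
  have "degree_preserving D"
    by (rule degree_preservingI[OF graded_basis_lag_rows lin L])
  then obtain K where K: "(\<forall>k>n. mpoly_coeff P k = 0) \<Longrightarrow>
      mpoly_coeff (D P) n = mpoly_coeff P n ** mpoly_eval K (real n)" for P n
    using mpoly_coeff_degree_preserving[OF D] by metis
  \<comment> \<open>Leading coefficients of both sides of the eigenvalue equation for R_n.\<close>
  have LK: "L n ** lag_rows_lead \<alpha> a n = lag_rows_lead \<alpha> a n ** mpoly_eval K (real n)" for n
    using K[of n "?R n"] by (simp add: L mpoly_coeff_const_mult mpoly_coeff_lag_rows)
  define g where "g = [:of_real (a * (1 + \<alpha>)), complex_of_real a:]"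
  define k where "k i j n = poly (K $ i $ j) (of_nat n)" for i j n
  have g: "complex_of_real (a * (real (Suc n) + \<alpha>)) = poly g (of_nat n)" for n
    by (simp add: g_def algebra_simps)
  define h where "h n = complex_of_real (1 + a^2 * real n)" for n
  have h: "h n \<noteq> 0" for n
    using one_plus_square_pos[of a n] unfolding h_def of_real_eq_0_iff by simp
  \<comment> \<open>The upper right entry is left out: solving for it divides by h n and gives only
    a rational function of n.\<close>
  have Lead: "L n $ 1 $ 1 = k 1 1 n - poly g (of_nat n) * k 2 1 n"
    "L n $ 2 $ 1 = h n * k 2 1 n" "L n $ 2 $ 2 = k 2 2 n + poly g (of_nat n) * k 2 1 n" for n
  proof -
    have eqs: "L n $ 1 $ 1 = k 1 1 n - poly g (of_nat n) * k 2 1 n"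
      "L n $ 2 $ 1 = h n * k 2 1 n"
      "h n * L n $ 2 $ 2 - poly g (of_nat n) * L n $ 2 $ 1 = h n * k 2 2 n"
      using LK[of n] unfolding mat2_eq_iff matrix_mult_nth_2 lag_rows_lead_def g h_def[symmetric]
      by (simp_all add: mpoly_eval_def k_def algebra_simps)
    then have "h n * L n $ 2 $ 2 = h n * (k 2 2 n + poly g (of_nat n) * k 2 1 n)"
      by (simp add: algebra_simps)
    then show "L n $ 1 $ 1 = k 1 1 n - poly g (of_nat n) * k 2 1 n"
      "L n $ 2 $ 1 = h n * k 2 1 n" "L n $ 2 $ 2 = k 2 2 n + poly g (of_nat n) * k 2 1 n"
      using eqs h[of n] by simp_all
  qed
  \<comment> \<open>The constant terms of the diagonal eigenvalues, as polynomials in t and s, are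
    split off; they are not yet known to agree.\<close>
  obtain c f1 where f1: "pcompose (K $ 1 $ 1 - g * K $ 2 $ 1) [:- of_real (1 + 1 / a^2), 1:] = pCons c f1"
    by (metis pCons_cases)
  obtain c' f4 where f4: "pcompose (K $ 2 $ 2 + g * K $ 2 $ 1) [:- of_real (1 / a^2), 1:] = pCons c' f4"
    by (metis pCons_cases)
  define f3 where "f3 = smult (of_real (a^2)) (pcompose (K $ 2 $ 1) [:- of_real (1 / a^2), 1:])"
  have "L n $ 1 $ 1 = c + eig_t a n * poly f1 (eig_t a n)" for n
    using poly_eig_t[of "K $ 1 $ 1 - g * K $ 2 $ 1" a n] unfolding f1 Lead by (simp add: k_def)
  moreover have "L n $ 2 $ 2 = c' + eig_s a n * poly f4 (eig_s a n)" for n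
    using poly_eig_s[of "K $ 2 $ 2 + g * K $ 2 $ 1" a n] unfolding f4 Lead by (simp add: k_def)
  moreover have "L n $ 2 $ 1 = eig_s a n * poly f3 (eig_s a n)" for n
  proof -
    have "h n = of_real (a^2) * eig_s a n"
      using a by (simp add: h_def eig_s_def field_simps flip: of_real_mult of_real_add)
    then show ?thesis
      unfolding Lead f3_def poly_smult poly_eig_s by (simp add: k_def)
  qed
  ultimately have L_eq: "L n = mat2 (c + eig_t a n * poly f1 (eig_t a n)) 0
      (eig_s a n * poly f3 (eig_s a n)) (c + eig_s a n * poly f4 (eig_s a n)) +
      mat2 0 (L n $ 1 $ 2) 0 (c' - c)" for n
    by (simp add: mat2_eq_iff)
  \<comment> \<open>With c in both diagonal places and 0 for the upper right, D - E retains only the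
    upper right entry and the defect c' - c, which \<open>second_column_eigenvalues\<close>
    treats.\<close>
  obtain E where E: "E \<in> lag_algebra \<alpha> a"
    and E_eig: "\<And>n. E (?R n) = mpoly_const (mat2 (c + eig_t a n * poly f1 (eig_t a n)) 0
      (eig_s a n * poly f3 (eig_s a n)) (c + eig_s a n * poly f4 (eig_s a n))) ** ?R n"
    using realizable_general[OF a, of \<alpha> c f1 0 f3 f4] unfolding realizable_def
    by (simp only: poly_0 mult_zero_right) blast
  define F where "F = mop_add D (mop_scale (-1) E)"
  have F: "F P = D P - E P" for P
    by (simp add: F_def mop_add_def mop_scale_def mpoly_scale_def vec_eq_iff)
  have F_ops: "F \<in> matrix_diff_ops"
    unfolding F_def mop_add_def
    by (intro matrix_diff_ops_add D matrix_diff_ops_scale lag_algebra_diff_ops[OF E])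
  have F_eig: "F (?R n) = mpoly_const (mat2 0 (L n $ 1 $ 2) 0 (c' - c)) ** ?R n" for n
    unfolding F L by (subst L_eq) (simp add: mpoly_const_add matrix_mult_add_left E_eig)
  note band = second_column_eigenvalues[OF \<alpha> a F_ops F_eig]
  obtain w where w: "\<And>n. L n $ 1 $ 2 = eig_t a n * of_real (real (Suc n) + \<alpha>) * poly w (eig_t a n)"
    using band(2) by blast
  obtain E' where E': "E' \<in> lag_algebra \<alpha> a"
    and E'_eig: "\<And>n. E' (?R n) = mpoly_const (mat2 0 (L n $ 1 $ 2) 0 0) ** ?R n"
    using realizable_general[OF a, of \<alpha> 0 0 w 0 0] unfolding realizable_def w
    by (simp only: poly_0 mult_zero_right add_0_left) blast
  have "F = E'"
    by (rule left_linear_eqI[OF graded_basis_lag_rows[of \<alpha> a]])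
       (use F_eig E'_eig band(1) left_linear_diff_op F_ops lag_algebra_diff_ops[OF E'] in simp_all)
  then have "D = mop_add E E'"
    by (simp add: mop_add_def F flip: \<open>F = E'\<close>)
  then show ?thesis
    using E E' by (simp add: lag_algebra_def generated_algebra.add)
qed

theorem theorem4p4:
  fixes \<alpha> a :: real
  assumes "\<alpha> > -1" and "a \<noteq> 0"
  shows "weight_diff_algebra 0 \<infinity> (W_lag \<alpha> a)
           = generated_algebra {mop_one, D1 \<alpha> a, D2 \<alpha> a, D3 \<alpha> a}"
  unfolding weight_diff_algebra_W_lag[OF assms(1)] lag_algebra_def[symmetric]
  using diff_op_in_lag_algebra[OF assms] lag_algebra_eigen[OF assms(2)] lag_algebra_diff_ops
  by blast

end
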